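(* If $\eta>0$ and $\beta>\max\left\{2\frac{\omega_{\max}}{b_{\min}},\,2\frac{\omega_{\max}^\flat}{b_{\min}^\flat}\right\}$, then $$\sigma\big(A(\beta)|_{H_{\ell\ell}(\beta)}\big)=\{\zeta\in\sigma(A(\beta)):0\le-\operatorname{Im}\zeta\le\omega_{\max}\},$$ $$\sigma\big(A(\beta)|_{H_{h\ell}(\beta)}\big)=\{\zeta\in\sigma(A(\beta)):-\operatorname{Im}\zeta\ge\beta b_{\min}-\omega_{\max}>\omega_{\max}\},\qquad \max_{\zeta\in\sigma(A(\beta)|_{H_{h\ell}(\beta)})}Q_\zeta\le\frac12\frac{\omega_{\max}}{\beta b_{\min}-\omega_{\max}}<\frac12,$$ and, in addition, $$\sigma\big(A(\beta)|_{H_{\ell\ell,0}(\beta)}\big)=\Big\{\zeta\in\sigma(A(\beta)):\frac{-\operatorname{Im}\zeta}{|\zeta|^2}\ge\beta b_{\min}^\flat-\omega_{\max}^\flat>\omega_{\max}^\flat\Big\}.$$ Furthermore, $$\max_{\zeta\in\sigma(A(\beta)|_{H_{\ell\ell,0}(\beta)})}Q_\zeta\le\frac12\frac{\omega_{\max}^\flat}{\beta b_{\min}^\flat-\omega_{\max}^\flat}<\frac12,\qquad \max_{\zeta\in\sigma(A(\beta)|_{H_{\ell\ell,0}(\beta)})}|\zeta|\le\frac{1}{\beta b_{\min}^\flat-\omega_{\max}^\flat}<\omega_{\min}.$$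
   Context: Setting. $N\ge 1$; $\alpha,\eta,\theta,R$ are real $N\times N$ matrices with $\alpha^{\mathrm T}=\alpha>0$, $\eta^{\mathrm T}=\eta\ge0$, $\theta^{\mathrm T}=-\theta$, $R^{\mathrm T}=R\ge0$, and $N_R=\operatorname{rank}R>0$; $\beta\ge0$. $\sqrt{\cdot}$ denotes the positive semidefinite square root. On $H=\mathbb C^{2N}=\mathbb C^N\oplus\mathbb C^N$ set $$\Omega=\begin{bmatrix}-2\mathrm i\sqrt\alpha^{-1}\theta\sqrt\alpha^{-1} & -\mathrm i\Phi^{\mathrm T}\\ \mathrm i\Phi&0\end{bmatrix},\quad \Phi=\sqrt\eta\sqrt\alpha^{-1},\quad B=\begin{bmatrix}\sqrt\alpha^{-1}R\sqrt\alpha^{-1}&0\\0&0\end{bmatrix},\quad A(\beta)=\Omega-\mathrm i\beta B .$$ $\Omega$ is Hermitian, $B\ge0$, $\operatorname{rank}B=N_R$; all eigenvalues $\zeta$ of $A(\beta)$ satisfy $\operatorname{Im}\zeta\le0$. $\omega_{\max}$ is the largest eigenvalue of $\Omega$ ($=\|\Omega\|$); $\omega_{\min}=\min|\sigma(\Omega)|$, which when $\eta>0$ is the smallest positive eigenvalue of $\Omega$; $b_{\min}$ is the smallest nonzero eigenvalue of $B$ (equivalently of $\alpha^{-1}R$); $0=b_0<b_1\le\dots\le b_{N_R}$ are the eigenvalue $0$ and the nonzero eigenvalues of $B$ (with multiplicity). The quality factor is $Q_\zeta=\frac12\frac{|\operatorname{Re}\zeta|}{-\operatorname{Im}\zeta}$,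 with $Q_\zeta=+\infty$ if $\operatorname{Im}\zeta=0\neq\operatorname{Re}\zeta$ and $Q_0=0$. Subspaces (known): let $D_j(\beta)=\{\zeta:|\zeta+\mathrm i\beta b_j|\le\omega_{\max}\}$, $\sigma_0(A(\beta))=\sigma(A(\beta))\cap D_0(\beta)$, $\sigma_1(A(\beta))=\sigma(A(\beta))\cap\bigcup_{j=1}^{N_R}D_j(\beta)$. If $\beta>2\omega_{\max}/b_{\min}$, then $\sigma(A(\beta))$ is the disjoint union of $\sigma_0$ and $\sigma_1$, and $H_{\ell\ell}(\beta)$, $H_{h\ell}(\beta)$ are the sums of the generalized eigenspaces of $A(\beta)$ for the eigenvalues in $\sigma_0$ and $\sigma_1$ respectively (of dimensions $2N-N_R$ and $N_R$). When $\eta>0$ and $\beta$ is as in the claim, $H_{\ell\ell,0}(\beta)\subseteq H_{\ell\ell}(\beta)$ is the sum of the generalized eigenspaces of $A(\beta)$ for the eigenvalues with $|\zeta|<\omega_{\min}$ (it has dimension $N_R$). Dual objects: when $\eta>0$, $\Omega^\flat$, $B^\flat$, $\omega_{\max}^\flat$, $b_{\min}^\flat$ are defined as $\Omega,B,\omega_{\max},b_{\min}$ but with $\alpha$ and $\eta$ interchanged. *)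

theory Defs
  imports "HOL-Analysis.Analysis" "HOL-Library.Extended_Real"
begin

definition psd :: "real^'n^'n \<Rightarrow> bool" where
  "psd M \<longleftrightarrow> transpose M = M \<and> (\<forall>x. 0 \<le> x \<bullet> (M *v x))"

definition pos_def :: "real^'n^'n \<Rightarrow> bool" where
  "pos_def M \<longleftrightarrow> transpose M = M \<and> (\<forall>x. x \<noteq> 0 \<longrightarrow> 0 < x \<bullet> (M *v x))"

definition psd_sqrt :: "real^'n^'n \<Rightarrow> real^'n^'n" where
  "psd_sqrt M = (THE S. psd S \<and> S ** S = M)"

definition inv_sqrt :: "real^'n^'n \<Rightarrow> real^'n^'n" where
  "inv_sqrt M = matrix_inv (psd_sqrt M)"

text \<open>The space \<open>\<complex>\<^sup>2\<^sup>N = \<complex>\<^sup>N \<oplus> \<complex>\<^sup>N\<close> is \<^typ>\<open>complex^('n + 'n)\<close>.\<close>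

definition block_matrix ::
  "'a^'n^'n \<Rightarrow> 'a^'n^'n \<Rightarrow> 'a^'n^'n \<Rightarrow> 'a^'n^'n \<Rightarrow> 'a^('n + 'n)^('n + 'n)" where
  "block_matrix P Q S T = (\<chi> i j. case i of
      Inl k \<Rightarrow> (case j of Inl l \<Rightarrow> P $ k $ l | Inr l \<Rightarrow> Q $ k $ l)
    | Inr k \<Rightarrow> (case j of Inl l \<Rightarrow> S $ k $ l | Inr l \<Rightarrow> T $ k $ l))"

text \<open>The complex multiple \<open>c M\<close> of a real matrix \<open>M\<close>.\<close>

definition cscale :: "complex \<Rightarrow> real^'n^'n \<Rightarrow> complex^'n^'n" where
  "cscale c M = map_matrix (\<lambda>x. c * complex_of_real x) M"

definition Phi :: "real^'n^'n \<Rightarrow> real^'n^'n \<Rightarrow> real^'n^'n" where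
  "Phi \<alpha> \<eta> = psd_sqrt \<eta> ** inv_sqrt \<alpha>"

definition Omega :: "real^'n^'n \<Rightarrow> real^'n^'n \<Rightarrow> real^'n^'n \<Rightarrow> complex^('n + 'n)^('n + 'n)" where
  "Omega \<alpha> \<eta> \<theta> = block_matrix
      (cscale (- 2 * \<i>) (inv_sqrt \<alpha> ** \<theta> ** inv_sqrt \<alpha>)) (cscale (- \<i>) (transpose (Phi \<alpha> \<eta>)))
      (cscale \<i> (Phi \<alpha> \<eta>)) 0"

definition Bmat :: "real^'n^'n \<Rightarrow> real^'n^'n \<Rightarrow> complex^('n + 'n)^('n + 'n)" where
  "Bmat \<alpha> R = block_matrix (cscale 1 (inv_sqrt \<alpha> ** R ** inv_sqrt \<alpha>)) 0 0 0"

definition Amat ::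
  "real^'n^'n \<Rightarrow> real^'n^'n \<Rightarrow> real^'n^'n \<Rightarrow> real^'n^'n \<Rightarrow> real \<Rightarrow> complex^('n + 'n)^('n + 'n)" where
  "Amat \<alpha> \<eta> \<theta> R \<beta> = Omega \<alpha> \<eta> \<theta> - map_matrix (\<lambda>z. \<i> * complex_of_real \<beta> * z) (Bmat \<alpha> R)"

text \<open>Spectrum of the restriction of \<open>M\<close> to an \<open>M\<close>-invariant subspace \<open>V\<close>; in finite
  dimension this is the set of eigenvalues of the restriction.\<close>

definition spectrum_on :: "complex^'m^'m \<Rightarrow> (complex^'m) set \<Rightarrow> complex set" where
  "spectrum_on M V = {\<zeta>. \<exists>v\<in>V. v \<noteq> 0 \<and> M *v v = \<zeta> *s v}"

definition spectrum :: "complex^'m^'m \<Rightarrow> complex set" where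
  "spectrum M = spectrum_on M UNIV"

text \<open>The power \<open>(M - \<zeta>)\<^sup>k\<close> is an iterated linear map, because \<open>^\<close> on the vector type
  is componentwise.\<close>

definition gen_eigenspace :: "complex^'m^'m \<Rightarrow> complex \<Rightarrow> (complex^'m) set" where
  "gen_eigenspace M \<zeta> = {v. \<exists>k. ((\<lambda>w. M *v w - \<zeta> *s w) ^^ k) v = 0}"

text \<open>\<^const>\<open>vec.span\<close> is the complex span, and so this is the sum of the generalized
  eigenspaces belonging to \<open>S\<close>; \<^const>\<open>span\<close> would be the real span.\<close>

definition gen_eigenspace_sum :: "complex^'m^'m \<Rightarrow> complex set \<Rightarrow> (complex^'m) set" where
  "gen_eigenspace_sum M S = vec.span (\<Union>\<zeta>\<in>S. gen_eigenspace M \<zeta>)"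

definition omega_max :: "real^'n^'n \<Rightarrow> real^'n^'n \<Rightarrow> real^'n^'n \<Rightarrow> real" where
  "omega_max \<alpha> \<eta> \<theta> = Max {w. complex_of_real w \<in> spectrum (Omega \<alpha> \<eta> \<theta>)}"

definition omega_min :: "real^'n^'n \<Rightarrow> real^'n^'n \<Rightarrow> real^'n^'n \<Rightarrow> real" where
  "omega_min \<alpha> \<eta> \<theta> = Min (cmod ` spectrum (Omega \<alpha> \<eta> \<theta>))"

definition nonzero_eigs_B :: "real^'n^'n \<Rightarrow> real^'n^'n \<Rightarrow> real set" where
  "nonzero_eigs_B \<alpha> R = {b. b \<noteq> 0 \<and> complex_of_real b \<in> spectrum (Bmat \<alpha> R)}"

definition b_min :: "real^'n^'n \<Rightarrow> real^'n^'n \<Rightarrow> real" where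
  "b_min \<alpha> R = Min (nonzero_eigs_B \<alpha> R)"

definition disc :: "real^'n^'n \<Rightarrow> real^'n^'n \<Rightarrow> real^'n^'n \<Rightarrow> real \<Rightarrow> real \<Rightarrow> complex set" where
  "disc \<alpha> \<eta> \<theta> \<beta> b =
     {\<zeta>. cmod (\<zeta> + \<i> * complex_of_real \<beta> * complex_of_real b) \<le> omega_max \<alpha> \<eta> \<theta>}"

definition sigma_0 ::
  "real^'n^'n \<Rightarrow> real^'n^'n \<Rightarrow> real^'n^'n \<Rightarrow> real^'n^'n \<Rightarrow> real \<Rightarrow> complex set" where
  "sigma_0 \<alpha> \<eta> \<theta> R \<beta> = spectrum (Amat \<alpha> \<eta> \<theta> R \<beta>) \<inter> disc \<alpha> \<eta> \<theta> \<beta> 0"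

definition sigma_1 ::
  "real^'n^'n \<Rightarrow> real^'n^'n \<Rightarrow> real^'n^'n \<Rightarrow> real^'n^'n \<Rightarrow> real \<Rightarrow> complex set" where
  "sigma_1 \<alpha> \<eta> \<theta> R \<beta> =
     spectrum (Amat \<alpha> \<eta> \<theta> R \<beta>) \<inter> (\<Union>b\<in>nonzero_eigs_B \<alpha> R. disc \<alpha> \<eta> \<theta> \<beta> b)"

definition H_ll ::
  "real^'n^'n \<Rightarrow> real^'n^'n \<Rightarrow> real^'n^'n \<Rightarrow> real^'n^'n \<Rightarrow> real \<Rightarrow> (complex^('n + 'n)) set" where
  "H_ll \<alpha> \<eta> \<theta> R \<beta> = gen_eigenspace_sum (Amat \<alpha> \<eta> \<theta> R \<beta>) (sigma_0 \<alpha> \<eta> \<theta> R \<beta>)"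

definition H_hl ::
  "real^'n^'n \<Rightarrow> real^'n^'n \<Rightarrow> real^'n^'n \<Rightarrow> real^'n^'n \<Rightarrow> real \<Rightarrow> (complex^('n + 'n)) set" where
  "H_hl \<alpha> \<eta> \<theta> R \<beta> = gen_eigenspace_sum (Amat \<alpha> \<eta> \<theta> R \<beta>) (sigma_1 \<alpha> \<eta> \<theta> R \<beta>)"

definition H_ll0 ::
  "real^'n^'n \<Rightarrow> real^'n^'n \<Rightarrow> real^'n^'n \<Rightarrow> real^'n^'n \<Rightarrow> real \<Rightarrow> (complex^('n + 'n)) set" where
  "H_ll0 \<alpha> \<eta> \<theta> R \<beta> = gen_eigenspace_sum (Amat \<alpha> \<eta> \<theta> R \<beta>)
     {\<zeta> \<in> spectrum (Amat \<alpha> \<eta> \<theta> R \<beta>). cmod \<zeta> < omega_min \<alpha> \<eta> \<theta>}"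

definition Qfactor :: "complex \<Rightarrow> ereal" where
  "Qfactor \<zeta> =
     (if \<zeta> = 0 then 0
      else if Im \<zeta> = 0 then \<infinity>
      else ereal (1/2 * (\<bar>Re \<zeta>\<bar> / (- Im \<zeta>))))"

text \<open>The dual quantities have \<open>\<alpha>\<close> and \<open>\<eta>\<close> interchanged.\<close>

definition omega_max_flat :: "real^'n^'n \<Rightarrow> real^'n^'n \<Rightarrow> real^'n^'n \<Rightarrow> real" where
  "omega_max_flat \<alpha> \<eta> \<theta> = omega_max \<eta> \<alpha> \<theta>"

definition b_min_flat :: "real^'n^'n \<Rightarrow> real^'n^'n \<Rightarrow> real" where
  "b_min_flat \<eta> R = b_min \<eta> R"

end

(*
  The eigenvalue equation of A(beta) is equivalent to the quadratic pencil
  eta q = z^2 alpha q + i z (2 theta + beta R) q, whose symmetry under exchanging alpha and eta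
  and replacing z by -1/z relates A(beta) to its dual.  A Bauer-Fike estimate in an eigenbasis of B
  places the spectrum in the discs.  That the far discs are not empty follows, without
  continuity of eigenvalues, from a Lyapunov argument: if H is 1 on ker B and -1 on ran B, then
  <x, H (i A(beta) - beta b_min / 2) x> has negative real part, while H is not positive definite, so that
  i A(beta) - beta b_min / 2 has an eigenvalue in the closed right half plane.
  The duality carries this eigenvalue to one near 0.
*)

theory Submission
  imports Defs "HOL-Computational_Algebra.Fundamental_Theorem_Algebra"
begin

subsection \<open>Self-adjoint operators\<close>

text \<open>\<open>A(\<beta>)\<close> is not normal in general, so only its Hermitian ingredients
  are diagonalised. One spectral theorem, for self-adjoint maps of a real Euclidean space, serves
  both the real matrices whose square roots occur and the Hermitian matrices on
  \<open>complex^('n + 'n)\<close>, regarded as a real space under the real part of the Hermitian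
  product. The price is that an eigenbasis is only a real basis, so complex linearity has to be
  recovered where it matters. The bounds on \<open>Max\<close> have content only for nonempty sets,
  \<open>Max {}\<close> being unspecified, and location estimates alone produce no eigenvalue; this
  is why a far eigenvalue must be shown to exist. The shift \<beta> b_min / 2 is the middle of the
  strip omega_max < - Im z < \<beta> b_min - omega_max. An eigenvalue above the middle is enough:
  the strip contains no spectrum, so such an eigenvalue lies in a far disc. The condition |z| <
  omega_min matches the dual picture because omega_min is the reciprocal of the dual
  omega_max.\<close>

definition selfadjoint :: "('a::euclidean_space \<Rightarrow> 'a) \<Rightarrow> bool" where
  "selfadjoint f \<longleftrightarrow> linear f \<and> (\<forall>x y. f x \<bullet> y = x \<bullet> f y)"

text \<open>On \<open>complex^'m\<close> the inner product is the real one, so there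
  \<open>E\<close> is a real orthonormal basis with \<open>2 * CARD('m)\<close> elements, and its
  coefficients are real.\<close>

definition eigenbasis :: "('a::euclidean_space \<Rightarrow> 'a) \<Rightarrow> 'a set \<Rightarrow> ('a \<Rightarrow> real) \<Rightarrow> bool" where
  "eigenbasis f E L \<longleftrightarrow> finite E
     \<and> (\<forall>e\<in>E. \<forall>e'\<in>E. e \<bullet> e' = (if e = e' then 1 else 0))
     \<and> (\<forall>e\<in>E. f e = L e *\<^sub>R e)
     \<and> (\<forall>v. v = (\<Sum>e\<in>E. (e \<bullet> v) *\<^sub>R e))"

text \<open>The first-order condition at a minimum, without derivatives: a nonzero linear term would
  dominate for small \<open>t\<close> of the opposite sign.\<close>

lemma quadratic_nonneg_imp_zero:
  fixes a b :: real
  assumes "\<And>t. 0 \<le> 2 * t * a + t\<^sup>2 * b"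
  shows "a = 0"
proof (rule ccontr)
  assume a: "a \<noteq> 0"
  \<comment> \<open>Chosen positive and above \<open>b\<close>, so that \<open>t = - a / d\<close>
    makes the expression a positive multiple of \<open>b - 2 * d < 0\<close>.\<close>
  define d where "d = \<bar>b\<bar> + 1"
  have d: "d > 0" "b < d" by (auto simp: d_def)
  have "0 \<le> 2 * (- a / d) * a + (- a / d)\<^sup>2 * b" by (rule assms)
  also have "\<dots> = (a\<^sup>2 / d\<^sup>2) * (b - 2 * d)"
    using d by (simp add: field_simps power2_eq_square)
  finally have "0 \<le> b - 2 * d"
    using a d by (simp add: zero_le_mult_iff zero_le_divide_iff)
  with d show False by linarith
qed

text \<open>A maximiser \<open>e\<close> of the Rayleigh quotient on the unit sphere of
  \<open>V\<close> is an eigenvector: the form of \<open>g = l - f\<close> is nonnegative on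
  \<open>V\<close> and vanishes at \<open>e\<close>, and moving \<open>e\<close> in the direction
  \<open>g e\<close> forces \<open>g e = 0\<close>.\<close>

lemma selfadjoint_has_eigenvector:
  fixes f :: "'a::euclidean_space \<Rightarrow> 'a"
  assumes f: "selfadjoint f" and V: "subspace V" "f ` V \<subseteq> V" "x0 \<in> V" "x0 \<noteq> 0"
  shows "\<exists>e\<in>V. \<exists>l. norm e = 1 \<and> f e = l *\<^sub>R e"
proof -
  have lin: "linear f" and sa: "\<And>x y. f x \<bullet> y = x \<bullet> f y"
    using f by (auto simp: selfadjoint_def)
  let ?S = "sphere 0 1 \<inter> V"
  have "compact ?S"
    by (intro compact_Int_closed closed_subspace V compact_sphere)
  moreover have "(1 / norm x0) *\<^sub>R x0 \<in> ?S"
    using V by (auto intro: subspace_scale)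
  then have "?S \<noteq> {}" by blast
  moreover have "continuous_on ?S (\<lambda>x. x \<bullet> f x)"
    by (intro continuous_intros linear_continuous_on) (simp add: lin linear_linear)
  ultimately obtain e where e: "e \<in> ?S" and max: "\<And>x. x \<in> ?S \<Longrightarrow> x \<bullet> f x \<le> e \<bullet> f e"
    using continuous_attains_sup by meson
  define l where "l = e \<bullet> f e"
  define g where "g x = l *\<^sub>R x - f x" for x
  have g_add: "g (x + y) = g x + g y" and g_scale: "g (c *\<^sub>R x) = c *\<^sub>R g x" for x y c
    by (simp_all add: g_def linear_add[OF lin] linear_scale[OF lin] algebra_simps)
  have g_sa: "g x \<bullet> y = x \<bullet> g y" for x y
    by (simp add: g_def inner_diff sa)
  have pos: "0 \<le> x \<bullet> g x" if "x \<in> V" for x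
  proof (cases "x = 0")
    case False
    have "(1 / norm x) *\<^sub>R x \<in> ?S" using that False V by (auto intro: subspace_scale)
    then have "((1 / norm x) *\<^sub>R x) \<bullet> f ((1 / norm x) *\<^sub>R x) \<le> l"
      unfolding l_def by (rule max)
    then have "x \<bullet> f x \<le> l * (norm x)\<^sup>2"
      using False by (simp add: linear_scale[OF lin] field_simps power2_eq_square)
    then show ?thesis by (simp add: g_def inner_diff power2_norm_eq_inner)
  qed simp
  have e1: "norm e = 1" "e \<in> V" using e by auto
  then have ge: "e \<bullet> g e = 0"
    by (simp add: g_def inner_diff l_def flip: power2_norm_eq_inner)
  have geV: "g e \<in> V" using e1 V by (auto simp: g_def intro: subspace_diff subspace_scale)
  have "g e \<bullet> g e = 0"
  proof (rule quadratic_nonneg_imp_zero)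
    fix t
    have "0 \<le> (e + t *\<^sub>R g e) \<bullet> g (e + t *\<^sub>R g e)"
      using e1 geV V by (intro pos) (auto intro: subspace_add subspace_scale)
    also have "\<dots> = 2 * t * (g e \<bullet> g e) + t\<^sup>2 * (g e \<bullet> g (g e))"
      using ge g_sa[of e "g e"]
      by (simp add: g_add g_scale inner_add algebra_simps power2_eq_square)
    finally show "0 \<le> 2 * t * (g e \<bullet> g e) + t\<^sup>2 * (g e \<bullet> g (g e))" .
  qed
  then have "f e = l *\<^sub>R e" by (simp add: g_def)
  with e1 show ?thesis by blast
qed

text \<open>Stated relative to an invariant subspace so that the induction can split off a unit
  eigenvector and pass to its orthogonal complement in \<open>V\<close>, which self-adjointness
  keeps invariant.\<close>

lemma selfadjoint_eigenbasis_on: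
  fixes f :: "'a::euclidean_space \<Rightarrow> 'a"
  assumes f: "selfadjoint f"
  shows "subspace V \<Longrightarrow> f ` V \<subseteq> V \<Longrightarrow> \<exists>E. finite E \<and> E \<subseteq> V
     \<and> (\<forall>e\<in>E. \<forall>e'\<in>E. e \<bullet> e' = (if e = e' then 1 else 0))
     \<and> (\<forall>e\<in>E. \<exists>l. f e = l *\<^sub>R e)
     \<and> (\<forall>v\<in>V. v = (\<Sum>e\<in>E. (e \<bullet> v) *\<^sub>R e))"
proof (induction "dim V" arbitrary: V rule: less_induct)
  case less
  have sa: "\<And>x y. f x \<bullet> y = x \<bullet> f y"
    using f by (auto simp: selfadjoint_def)
  show ?case
  proof (cases "V \<subseteq> {0}")
    case True
    then show ?thesis by (intro exI[of _ "{}"]) auto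
  next
    case False
    then obtain x0 where "x0 \<in> V" "x0 \<noteq> 0" by blast
    from selfadjoint_has_eigenvector[OF f less.prems this]
    obtain e l where e: "e \<in> V" "norm e = 1" "f e = l *\<^sub>R e" by blast
    have ee: "e \<bullet> e = 1" using e(2) by (simp add: dot_square_norm)
    define W where "W = {x\<in>V. e \<bullet> x = 0}"
    have W: "subspace W"
      using less.prems(1) by (auto simp: W_def subspace_def inner_add)
    have fW: "f ` W \<subseteq> W"
      using less.prems(2) by (auto simp: W_def sa[symmetric] e)
    have "e \<notin> W" using ee by (auto simp: W_def)
    then have "W \<subset> V" using e(1) unfolding W_def by blast
    then have "dim W < dim V"
      using W less.prems(1) by (intro dim_psubset) (metis span_eq_iff)
    from less.hyps[OF this W fW] obtain E where E: "finite E" "E \<subseteq> W"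
      "\<forall>e\<in>E. \<forall>e'\<in>E. e \<bullet> e' = (if e = e' then 1 else 0)"
      "\<forall>e\<in>E. \<exists>l. f e = l *\<^sub>R e" "\<forall>v\<in>W. v = (\<Sum>e\<in>E. (e \<bullet> v) *\<^sub>R e)" by blast
    have eE: "e \<bullet> x = 0" "x \<bullet> e = 0" if "x \<in> E" for x
      using that E(2) by (auto simp: W_def inner_commute)
    have enE: "e \<notin> E" using E(2) \<open>e \<notin> W\<close> by blast
    have "v = (\<Sum>x\<in>insert e E. (x \<bullet> v) *\<^sub>R x)" if v: "v \<in> V" for v
    proof -
      have "v - (e \<bullet> v) *\<^sub>R e \<in> W"
        using v e ee less.prems(1) by (auto simp: W_def inner_diff intro: subspace_diff subspace_scale)
      then have "v - (e \<bullet> v) *\<^sub>R e = (\<Sum>x\<in>E. (x \<bullet> (v - (e \<bullet> v) *\<^sub>R e)) *\<^sub>R x)"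
        using E(5) by blast
      also have "\<dots> = (\<Sum>x\<in>E. (x \<bullet> v) *\<^sub>R x)"
        by (intro sum.cong) (auto simp: inner_diff eE)
      finally show ?thesis using E(1) enE by (simp add: algebra_simps)
    qed
    moreover have "\<forall>x\<in>insert e E. \<forall>x'\<in>insert e E. x \<bullet> x' = (if x = x' then 1 else 0)"
      using E(3) ee eE enE by auto
    moreover have "insert e E \<subseteq> V" using e E(2) by (auto simp: W_def)
    ultimately show ?thesis using E(1,4) e(3) by (intro exI[of _ "insert e E"]) auto
  qed
qed

theorem selfadjoint_eigenbasis:
  assumes "selfadjoint f"
  obtains E L where "eigenbasis f E L"
proof -
  from selfadjoint_eigenbasis_on[OF assms subspace_UNIV] obtain E where
    E: "finite E" "\<forall>e\<in>E. \<forall>e'\<in>E. e \<bullet> e' = (if e = e' then 1 else 0)"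
      "\<forall>e\<in>E. \<exists>l. f e = l *\<^sub>R e" "\<forall>v. v = (\<Sum>e\<in>E. (e \<bullet> v) *\<^sub>R e)" by auto
  from E(3) obtain L where "\<forall>e\<in>E. f e = L e *\<^sub>R e" by metis
  with E show thesis by (intro that[of E L]) (auto simp: eigenbasis_def)
qed

section \<open>Functional calculus in an eigenbasis\<close>

definition fun_calc :: "'a::euclidean_space set \<Rightarrow> ('a \<Rightarrow> real) \<Rightarrow> (real \<Rightarrow> real) \<Rightarrow> 'a \<Rightarrow> 'a" where
  "fun_calc E L h v = (\<Sum>e\<in>E. (h (L e) * (e \<bullet> v)) *\<^sub>R e)"

context
  fixes f :: "'a::euclidean_space \<Rightarrow> 'a" and E L
  assumes sa: "selfadjoint f" and eb: "eigenbasis f E L"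
begin

lemma eb_expand: "v = (\<Sum>e\<in>E. (e \<bullet> v) *\<^sub>R e)"
  using eb by (auto simp: eigenbasis_def)

lemma eb_coeff_sum:
  assumes "e \<in> E"
  shows "e \<bullet> (\<Sum>x\<in>E. c x *\<^sub>R x) = c e"
proof -
  have "e \<bullet> (\<Sum>x\<in>E. c x *\<^sub>R x) = (\<Sum>x\<in>E. c x * (e \<bullet> x))"
    by (simp add: inner_sum_right)
  also have "\<dots> = (\<Sum>x\<in>E. if e = x then c x else 0)"
    using eb assms by (intro sum.cong) (auto simp: eigenbasis_def)
  also have "\<dots> = c e" using eb assms by (simp add: eigenbasis_def)
  finally show ?thesis .
qed

lemma eb_inner: "x \<bullet> y = (\<Sum>e\<in>E. (e \<bullet> x) * (e \<bullet> y))"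
  by (subst eb_expand[of x]) (simp add: inner_sum_left)

lemma eb_op: "e \<in> E \<Longrightarrow> e \<bullet> f x = L e * (e \<bullet> x)"
  using sa eb unfolding selfadjoint_def eigenbasis_def by (metis inner_scaleR_left)

lemma eb_calc: "e \<in> E \<Longrightarrow> e \<bullet> fun_calc E L h x = h (L e) * (e \<bullet> x)"
  unfolding fun_calc_def by (rule eb_coeff_sum)

lemma eb_eqI: "(\<And>e. e \<in> E \<Longrightarrow> e \<bullet> x = e \<bullet> y) \<Longrightarrow> x = y"
  by (subst eb_expand[of x], subst eb_expand[of y]) simp

text \<open>\<open>v\<close> need not belong to \<open>E\<close>: its coefficients vanish at all
  basis vectors with an eigenvalue other than \<open>l\<close>. The action on eigenvectors is
  therefore independent of the chosen basis, which gives the uniqueness of square roots.\<close>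

lemma fun_calc_eigen:
  assumes "f v = l *\<^sub>R v"
  shows "fun_calc E L h v = h l *\<^sub>R v"
proof (rule eb_eqI)
  fix e assume e: "e \<in> E"
  have "L e * (e \<bullet> v) = l * (e \<bullet> v)"
    using eb_op[OF e, of v] unfolding assms inner_scaleR_right by (rule sym)
  then have "h (L e) * (e \<bullet> v) = h l * (e \<bullet> v)" by (cases "e \<bullet> v = 0") auto
  then show "e \<bullet> fun_calc E L h v = e \<bullet> (h l *\<^sub>R v)"
    using e by (simp add: eb_calc)
qed

lemma selfadjoint_fun_calc: "selfadjoint (fun_calc E L h)"
proof -
  have "linear (fun_calc E L h)"
    by (rule linearI) (rule eb_eqI, simp add: eb_calc inner_add algebra_simps)+
  moreover have "fun_calc E L h x \<bullet> y = x \<bullet> fun_calc E L h y" for x y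
    unfolding eb_inner[of "fun_calc E L h x"] eb_inner[of x] by (simp add: eb_calc algebra_simps)
  ultimately show ?thesis by (simp add: selfadjoint_def)
qed

text \<open>Applied to multiplication by \<open>\<i>\<close>, this makes the functional calculus complex linear.\<close>

lemma fun_calc_commute:
  assumes g: "linear g" and comm: "\<And>x. f (g x) = g (f x)"
  shows "fun_calc E L h (g v) = g (fun_calc E L h v)"
proof -
  \<comment> \<open>\<open>g e\<close> satisfies the eigenvalue equation of \<open>e\<close>,
    although it lies outside \<open>E\<close> in general.\<close>
  have fce: "fun_calc E L h (g e) = h (L e) *\<^sub>R g e" if "e \<in> E" for e
    using that eb by (intro fun_calc_eigen)
      (simp add: comm eigenbasis_def linear_scale[OF g])
  have lin: "linear (fun_calc E L h)" using selfadjoint_fun_calc by (simp add: selfadjoint_def)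
  have "fun_calc E L h (g v) = fun_calc E L h (g (\<Sum>e\<in>E. (e \<bullet> v) *\<^sub>R e))"
    using eb_expand[of v] by simp
  also have "\<dots> = (\<Sum>e\<in>E. (e \<bullet> v) *\<^sub>R fun_calc E L h (g e))"
    by (simp add: linear_sum[OF g] linear_sum[OF lin] linear_scale[OF g] linear_scale[OF lin])
  also have "\<dots> = g (fun_calc E L h v)"
    by (simp add: fce) (simp add: fun_calc_def linear_sum[OF g] linear_scale[OF g] mult.commute)
  finally show ?thesis .
qed

end

subsection \<open>The positive semidefinite square root\<close>

lemma selfadjoint_real_matrix:
  fixes M :: "real^'n^'n"
  assumes "transpose M = M"
  shows "selfadjoint ((*v) M)"
  using dot_lmul_matrix[of _ M] vector_transpose_matrix[of _ M] assms
  by (simp add: selfadjoint_def)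

text \<open>Justifies the definite description in \<open>psd_sqrt\<close>. Existence is the
  functional calculus for \<open>sqrt\<close>. Uniqueness diagonalises the competitor
  \<open>S\<close> instead of \<open>M\<close>: on an eigenvector of \<open>S\<close>,
  \<open>M\<close> acts by the squared eigenvalue, hence \<open>T\<close> acts by its nonnegative
  root.\<close>

lemma psd_sqrt_ex1:
  fixes M :: "real^'n^'n"
  assumes "psd M"
  shows "\<exists>!S. psd S \<and> S ** S = M"
proof -
  have saM: "selfadjoint ((*v) M)" using assms by (simp add: psd_def selfadjoint_real_matrix)
  obtain E L where eb: "eigenbasis ((*v) M) E L" using selfadjoint_eigenbasis[OF saM] .
  note fc = eb_calc[OF saM eb] and eqI = eb_eqI[OF saM eb]
  have L: "L e \<ge> 0" if "e \<in> E" for e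
  proof -
    have "0 \<le> e \<bullet> (M *v e)" using assms by (simp add: psd_def)
    also have "\<dots> = L e" using eb that by (simp add: eigenbasis_def)
    finally show ?thesis .
  qed
  define T where "T = fun_calc E L sqrt"
  have saT: "selfadjoint T" unfolding T_def by (rule selfadjoint_fun_calc[OF saM eb])
  then have linT: "linear T" by (simp add: selfadjoint_def)
  have Tv: "matrix T *v x = T x" for x by (rule fun_cong[OF matrix_vector_mul(2)[OF linT]])
  have fcT: "e \<bullet> T x = sqrt (L e) * (e \<bullet> x)" if "e \<in> E" for e x
    unfolding T_def using that by (rule fc)
  have "transpose (matrix T) = matrix T"
  proof -
    have "x \<bullet> (transpose (matrix T) *v y) = x \<bullet> (matrix T *v y)" for x y
    proof -
      have "x \<bullet> (transpose (matrix T) *v y) = T x \<bullet> y"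
        using dot_lmul_matrix[of x "transpose (matrix T)" y] by (simp add: Tv)
      then show ?thesis using saT by (simp add: selfadjoint_def Tv)
    qed
    then show ?thesis unfolding matrix_eq by (metis vector_eq_ldot)
  qed
  moreover
  have "0 \<le> x \<bullet> (matrix T *v x)" for x
    unfolding Tv eb_inner[OF saM eb, of x]
    by (intro sum_nonneg) (simp add: fcT L mult.left_commute[of _ "sqrt _"])
  moreover have "matrix T ** matrix T = M"
    unfolding matrix_eq
  proof (intro allI eqI)
    fix x e assume e: "e \<in> E"
    then show "e \<bullet> (matrix T ** matrix T *v x) = e \<bullet> (M *v x)"
      by (simp add: matrix_vector_mul_assoc[symmetric] Tv fcT eb_op[OF saM eb] L)
  qed
  ultimately have ex: "psd (matrix T) \<and> matrix T ** matrix T = M" by (simp add: psd_def)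
  moreover have "S = matrix T" if S: "psd S \<and> S ** S = M" for S
  proof -
    have saS: "selfadjoint ((*v) S)" using S by (simp add: psd_def selfadjoint_real_matrix)
    obtain E' L' where eb': "eigenbasis ((*v) S) E' L'" using selfadjoint_eigenbasis[OF saS] .
    have "S *v e = T e" if e: "e \<in> E'" for e
    proof -
      have Se: "S *v e = L' e *\<^sub>R e" and ee: "e \<bullet> e = 1" using eb' e by (auto simp: eigenbasis_def)
      have "0 \<le> e \<bullet> (S *v e)" using S by (simp add: psd_def)
      then have L': "L' e \<ge> 0" by (simp add: Se ee)
      have "M *v e = (L' e)\<^sup>2 *\<^sub>R e"
        unfolding conjunct2[OF S, symmetric]
        by (simp add: Se matrix_vector_mul_assoc[symmetric] matrix_vector_mult_scaleR power2_eq_square)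
      then have "T e = sqrt ((L' e)\<^sup>2) *\<^sub>R e"
        unfolding T_def by (rule fun_calc_eigen[OF saM eb])
      then show ?thesis using L' Se by simp
    qed
    then have "S *v v = T v" for v
      by (subst (1 2) eb_expand[OF saS eb', of v])
        (simp add: linear_sum[OF linT] linear_scale[OF linT] matrix_vector_mult_scaleR
          linear_sum[OF matrix_vector_mul_linear])
    then show ?thesis by (simp add: matrix_eq Tv)
  qed
  ultimately show ?thesis by blast
qed

lemma psd_sqrt:
  assumes "psd M"
  shows "psd (psd_sqrt M)" "psd_sqrt M ** psd_sqrt M = M"
  using theI'[OF psd_sqrt_ex1[OF assms]] by (auto simp: psd_sqrt_def)

lemma pos_def_imp_psd: "pos_def M \<Longrightarrow> psd M"
  unfolding pos_def_def psd_def by (metis inner_zero_left order.refl order.strict_implies_order)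

lemma inv_sqrt:
  assumes "pos_def M"
  shows "psd_sqrt M ** inv_sqrt M = mat 1" "inv_sqrt M ** psd_sqrt M = mat 1"
    "transpose (inv_sqrt M) = inv_sqrt M"
proof -
  note s = psd_sqrt[OF pos_def_imp_psd[OF assms]]
  have "x = 0" if "psd_sqrt M *v x = 0" for x
  proof -
    have "(psd_sqrt M ** psd_sqrt M) *v x = 0" using that by (simp add: matrix_vector_mul_assoc[symmetric])
    then have "M *v x = 0" by (simp only: s(2))
    then show ?thesis using assms by (auto simp: pos_def_def)
  qed
  then have inv: "invertible (psd_sqrt M)"
    unfolding invertible_left_inverse matrix_left_invertible_ker by blast
  then have "psd_sqrt M ** inv_sqrt M = mat 1 \<and> inv_sqrt M ** psd_sqrt M = mat 1"
    unfolding invertible_def inv_sqrt_def matrix_inv_def by (rule someI_ex)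
  then show 1: "psd_sqrt M ** inv_sqrt M = mat 1" and 2: "inv_sqrt M ** psd_sqrt M = mat 1"
    by simp_all
  have "transpose (inv_sqrt M) ** psd_sqrt M = mat 1"
    using arg_cong[OF 1, of transpose] s(1) by (simp add: matrix_transpose_mul psd_def transpose_mat)
  then have "transpose (inv_sqrt M) ** (psd_sqrt M ** inv_sqrt M) = inv_sqrt M"
    by (simp add: matrix_mul_assoc)
  then show "transpose (inv_sqrt M) = inv_sqrt M" by (simp add: 1)
qed

subsection \<open>Polynomials of an operator\<close>

text \<open>Horner's scheme for p(f) at a vector; the recursion over \<open>pCons\<close> is the
  induction pattern of the lemmas about it.\<close>

definition poly_op :: "(complex^'m \<Rightarrow> complex^'m) \<Rightarrow> complex poly \<Rightarrow> complex^'m \<Rightarrow> complex^'m" where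
  "poly_op f p x = fold_coeffs (\<lambda>a y. a *s x + f y) p 0"

context
  fixes f :: "complex^'m \<Rightarrow> complex^'m"
  assumes lin: "Vector_Spaces.linear (*s) (*s) f"
begin

lemma op_simps: "f 0 = 0" "f (x + y) = f x + f y" "f (x - y) = f x - f y" "f (c *s x) = c *s f x"
  using lin by (auto simp: vec.linear_0 vec.linear_add vec.linear_diff vec.linear_scale)

lemma poly_op_0 [simp]: "poly_op f 0 x = 0"
  by (simp add: poly_op_def)

lemma poly_op_pCons [simp]: "poly_op f (pCons a p) x = a *s x + f (poly_op f p x)"
  by (cases "p = 0 \<and> a = 0") (auto simp: poly_op_def op_simps)

lemma poly_op_add: "poly_op f (p + q) x = poly_op f p x + poly_op f q x"
  by (induction p q rule: poly_induct2) (simp_all add: op_simps algebra_simps)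

lemma poly_op_smult: "poly_op f (smult c p) x = c *s poly_op f p x"
  by (induction p) (simp_all add: op_simps vec.scale_right_distrib)

lemma poly_op_mult: "poly_op f (p * q) x = poly_op f p (poly_op f q x)"
  by (induction p) (simp_all add: poly_op_add poly_op_smult)

lemma poly_op_mult': "poly_op f (p * q) x = poly_op f q (poly_op f p x)"
  by (metis mult.commute poly_op_mult)

lemma poly_op_linear_factor: "poly_op f ([:- z, 1:] * q) x = f (poly_op f q x) - z *s poly_op f q x"
  by (simp only: poly_op_mult) (simp add: op_simps)

lemma poly_op_sum: "poly_op f (\<Sum>i\<in>I. p i) x = (\<Sum>i\<in>I. poly_op f (p i) x)"
  by (induction I rule: infinite_finite_induct) (simp_all add: poly_op_add)

lemma poly_op_monom: "poly_op f (monom c i) x = c *s (f ^^ i) x"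
  by (induction i) (simp_all add: monom_0 monom_Suc op_simps)

lemma poly_op_vec_add: "poly_op f p (x + y) = poly_op f p x + poly_op f p y"
  by (induction p) (simp_all add: op_simps vec.scale_right_distrib)

lemma poly_op_vec_scale: "poly_op f p (c *s x) = c *s poly_op f p x"
  by (induction p) (simp_all add: op_simps vec.scale_right_distrib mult.commute)

lemma poly_op_vec_0 [simp]: "poly_op f p 0 = 0"
  using poly_op_vec_scale[of p 0 0] by simp

lemma poly_op_eigen: "f v = \<mu> *s v \<Longrightarrow> poly_op f p v = poly p \<mu> *s v"
  by (induction p) (simp_all add: op_simps vec.scale_left_distrib mult.commute)

lemma poly_op_in_subspace:
  assumes "vec.subspace V" "f ` V \<subseteq> V" "x \<in> V"
  shows "poly_op f p x \<in> V"
  using assms by (induction p) (auto intro: vec.subspace_0 vec.subspace_add vec.subspace_scale)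

lemma annihilating_poly: "\<exists>p. p \<noteq> 0 \<and> poly_op f p x = 0"
\<comment> \<open>The dependence argument counts a set of vectors, so the \<open>n + 1\<close>
  iterates in dimension \<open>n\<close> have to be distinct. If two iterates coincide, their
  difference is already a polynomial relation.\<close>
proof (cases "inj (\<lambda>i. (f ^^ i) x)")
  case False
  then obtain i j where "i \<noteq> j" "(f ^^ i) x = (f ^^ j) x" by (auto simp: inj_def)
  then have "poly_op f (monom 1 i + monom (-1) j) x = 0"
    by (simp add: poly_op_add poly_op_monom)
  moreover have "coeff (monom 1 i + monom (-1) j :: complex poly) i \<noteq> 0"
    using \<open>i \<noteq> j\<close> by simp
  then have "monom 1 i + monom (-1) j \<noteq> (0 :: complex poly)" by force
  ultimately show ?thesis by blast
next
  case True
  define n where "n = CARD('m)"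
  let ?S = "(\<lambda>i. (f ^^ i) x) ` {..n}"
  have inj: "inj_on (\<lambda>i. (f ^^ i) x) {..n}" using True by (rule inj_on_subset) simp
  have "vec.dependent ?S"
  proof (rule ccontr)
    assume "\<not> vec.dependent ?S"
    then have "card ?S \<le> vec.dim (UNIV :: (complex^'m) set)"
      by (intro vec.independent_card_le_dim) auto
    then show False using inj by (simp add: card_image vec_dim_card n_def card_cart_basis)
  qed
  then obtain u where u: "(\<Sum>v\<in>?S. u v *s v) = 0" "\<exists>v\<in>?S. u v \<noteq> 0"
    by (auto simp: vec.dependent_finite)
  define p where "p = (\<Sum>i\<le>n. monom (u ((f ^^ i) x)) i)"
  have "poly_op f p x = 0"
    using u(1) inj by (simp add: p_def poly_op_sum poly_op_monom sum.reindex)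
  moreover obtain k where "k \<le> n" "u ((f ^^ k) x) \<noteq> 0" using u(2) by auto
  then have "coeff p k \<noteq> 0" by (simp add: p_def coeff_sum)
  then have "p \<noteq> 0" by auto
  ultimately show ?thesis by blast
qed

text \<open>Take a polynomial of least degree that annihilates \<open>y\<close> and split off a root
  \<open>z\<close>. By minimality the cofactor \<open>q\<close> does not annihilate
  \<open>y\<close>, so \<open>q(f) y\<close> is an eigenvector for \<open>z\<close>, and it stays in
  the invariant subspace.\<close>

lemma exists_eigenvector:
  assumes V: "vec.subspace V" "f ` V \<subseteq> V" and y: "y \<in> V" "y \<noteq> 0"
  shows "\<exists>z. \<exists>v\<in>V. v \<noteq> 0 \<and> f v = z *s v"
proof -
  obtain p where p: "p \<noteq> 0" "poly_op f p y = 0"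
    and min: "\<And>q. q \<noteq> 0 \<Longrightarrow> poly_op f q y = 0 \<Longrightarrow> degree p \<le> degree q"
    using annihilating_poly[of y]
      ex_has_least_nat[of "\<lambda>p. p \<noteq> 0 \<and> poly_op f p y = 0" _ degree] by blast
  have "\<not> constant (poly p)"
  proof
    assume "constant (poly p)"
    then obtain c where "p = [:c:]" by (metis constant_degree degree_0_id degree_eq_zeroE)
    with p y show False by (simp add: op_simps)
  qed
  then obtain z where "poly p z = 0" using fundamental_theorem_of_algebra by blast
  then obtain q where q: "p = [:- z, 1:] * q" by (auto simp: poly_eq_0_iff_dvd)
  with p have "q \<noteq> 0" by auto
  moreover from this have "degree p = Suc (degree q)" unfolding q by (subst degree_mult_eq) auto
  ultimately have "poly_op f q y \<noteq> 0" using min[of q] by auto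
  moreover have "f (poly_op f q y) = z *s poly_op f q y"
    using p(2) unfolding q poly_op_linear_factor by simp
  ultimately show ?thesis using poly_op_in_subspace[OF V y(1)] by blast
qed

end

text \<open>No determinant is involved: polynomials in one operator commute, so the product of
  annihilating polynomials of the basis vectors kills the whole space, and every eigenvalue is one
  of its roots.\<close>

lemma finite_spectrum: "finite (spectrum M)"
proof -
  have lin: "Vector_Spaces.linear (*s) (*s) ((*v) M)" by simp
  note pm = poly_op_mult[OF lin] poly_op_mult'[OF lin]
  have "\<exists>P. P \<noteq> 0 \<and> (\<forall>x\<in>S. poly_op ((*v) M) P x = 0)" if "finite S" for S
    using that
  proof induction
    case (insert x S)
    then obtain P where P: "P \<noteq> 0" "\<forall>x\<in>S. poly_op ((*v) M) P x = 0" by blast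
    obtain p where "p \<noteq> 0" "poly_op ((*v) M) p x = 0" using annihilating_poly[OF lin] by blast
    moreover from this have "poly_op ((*v) M) (P * p) x = 0"
      by (simp add: pm(1) poly_op_vec_0[OF lin])
    moreover have "poly_op ((*v) M) (P * p) y = 0" if "y \<in> S" for y
      using P(2) that by (simp add: pm(2) poly_op_vec_0[OF lin])
    ultimately show ?case using P(1) by (intro exI[of _ "P * p"]) auto
  qed (auto intro: exI[of _ 1])
  from this[of cart_basis] obtain P where P: "P \<noteq> 0" "\<And>x. x \<in> cart_basis \<Longrightarrow> poly_op ((*v) M) P x = 0"
    using finite_cart_basis by blast
  have "vec.subspace {x. poly_op ((*v) M) P x = 0}"
    by (auto simp: vec.subspace_def poly_op_vec_0[OF lin] poly_op_vec_add[OF lin] poly_op_vec_scale[OF lin])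
  then have "vec.span cart_basis \<subseteq> {x. poly_op ((*v) M) P x = 0}"
    using P(2) by (intro vec.span_minimal) auto
  then have "poly_op ((*v) M) P x = 0" for x by (auto simp: span_cart_basis)
  then have "spectrum M \<subseteq> {z. poly P z = 0}"
    by (auto simp: spectrum_def spectrum_on_def) (metis lin poly_op_eigen vec.scale_eq_0_iff)
  then show ?thesis using poly_roots_finite[OF P(1)] by (rule finite_subset)
qed

text \<open>Identifies the restricted spectra for all three subspaces, and so reduces the set
  equalities of the theorem to the location of the spectrum.\<close>

lemma spectrum_on_gen_eigenspace_sum:
  assumes S: "S \<subseteq> spectrum M"
  shows "spectrum_on M (gen_eigenspace_sum M S) = S"
proof
  have lin: "Vector_Spaces.linear (*s) (*s) ((*v) M)" by simp
  show "S \<subseteq> spectrum_on M (gen_eigenspace_sum M S)"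
  proof
    fix z assume z: "z \<in> S"
    with S obtain v where v: "v \<noteq> 0" "M *v v = z *s v" by (auto simp: spectrum_def spectrum_on_def)
    then have "((\<lambda>w. M *v w - z *s w) ^^ 1) v = 0" by simp
    then have "v \<in> gen_eigenspace M z" unfolding gen_eigenspace_def by blast
    then have "v \<in> gen_eigenspace_sum M S"
      unfolding gen_eigenspace_sum_def using z by (blast intro: vec.span_base)
    with v show "z \<in> spectrum_on M (gen_eigenspace_sum M S)" by (auto simp: spectrum_on_def)
  qed
  show "spectrum_on M (gen_eigenspace_sum M S) \<subseteq> S"
  proof
    fix \<mu> assume "\<mu> \<in> spectrum_on M (gen_eigenspace_sum M S)"
    then obtain v where v: "v \<in> gen_eigenspace_sum M S" "v \<noteq> 0" "M *v v = \<mu> *s v"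
      by (auto simp: spectrum_on_def)
    \<comment> \<open>The vectors killed by a nonzero polynomial with all roots in \<open>S\<close>.
      Products of polynomials make this a subspace, and it contains the generalized eigenspaces. On
      an eigenvector for \<open>\<mu>\<close> such a polynomial acts by \<open>poly p \<mu>\<close>,
      so \<open>\<mu>\<close> is one of the roots.\<close>
    define W where "W = {x. \<exists>p. p \<noteq> 0 \<and> poly_op ((*v) M) p x = 0 \<and> {z. poly p z = 0} \<subseteq> S}"
    have "vec.subspace W"
      unfolding vec.subspace_def
    proof (intro conjI ballI allI)
      have "poly_op ((*v) M) 1 0 = 0" by (rule poly_op_vec_0[OF lin])
      then show "0 \<in> W" unfolding W_def by (intro CollectI exI[of _ 1]) simp
    next
      fix x y assume "x \<in> W" "y \<in> W"
      then obtain p q where "p \<noteq> 0" "poly_op ((*v) M) p x = 0" "{z. poly p z = 0} \<subseteq> S"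
        "q \<noteq> 0" "poly_op ((*v) M) q y = 0" "{z. poly q z = 0} \<subseteq> S"
        by (auto simp: W_def)
      moreover from this have "poly_op ((*v) M) (p * q) (x + y) = 0"
        unfolding poly_op_vec_add[OF lin]
        by (simp only: poly_op_mult'[OF lin, of p q x] poly_op_mult[OF lin, of p q y] poly_op_vec_0[OF lin]) simp
      ultimately show "x + y \<in> W"
        unfolding W_def by (intro CollectI exI[of _ "p * q"]) auto
    next
      fix c x assume "x \<in> W"
      then obtain p where "p \<noteq> 0" "poly_op ((*v) M) p x = 0" "{z. poly p z = 0} \<subseteq> S"
        by (auto simp: W_def)
      then show "c *s x \<in> W"
        unfolding W_def by (intro CollectI exI[of _ p]) (simp add: poly_op_vec_scale[OF lin])
    qed
    moreover have "gen_eigenspace M z \<subseteq> W" if z: "z \<in> S" for z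
    proof
      fix x assume "x \<in> gen_eigenspace M z"
      then obtain k where k: "((\<lambda>w. M *v w - z *s w) ^^ k) x = 0" by (auto simp: gen_eigenspace_def)
      have "((\<lambda>w. M *v w - z *s w) ^^ k) x = poly_op ((*v) M) ([:- z, 1:] ^ k) x"
      proof (induction k)
        case 0
        show ?case by (simp add: one_pCons poly_op_pCons[OF lin] poly_op_0[OF lin])
      next
        case (Suc k)
        then show ?case by (simp only: funpow.simps comp_apply power_Suc poly_op_linear_factor[OF lin])
      qed
      with k have "poly_op ((*v) M) ([:- z, 1:] ^ k) x = 0" by simp
      moreover have "{y. poly ([:- z, 1:] ^ k) y = 0} \<subseteq> S" using z by auto
      ultimately show "x \<in> W" unfolding W_def by (intro CollectI exI[of _ "[:- z, 1:] ^ k"]) simp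
    qed
    ultimately have "gen_eigenspace_sum M S \<subseteq> W"
      unfolding gen_eigenspace_sum_def by (intro vec.span_minimal) auto
    then obtain p where "poly_op ((*v) M) p v = 0" "{z. poly p z = 0} \<subseteq> S"
      using v(1) by (auto simp: W_def)
    moreover have "poly_op ((*v) M) p v = poly p \<mu> *s v" by (rule poly_op_eigen[OF lin v(3)])
    ultimately show "\<mu> \<in> S" using v(2) by auto
  qed
qed

subsection \<open>An inertia argument for the existence of eigenvalues\<close>

text \<open>Split off an eigenvector \<open>v\<close>: if \<open>h v v > 0\<close>, then \<open>f\<close> is compressed to the
  \<open>h\<close>-orthogonal complement of \<open>v\<close>, which does not change \<open>h x (f x)\<close> there and
  lowers the dimension.\<close>

lemma exists_eigenvalue_Re_nonneg:
  fixes h :: "complex^'m \<Rightarrow> complex^'m \<Rightarrow> complex"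
  assumes h_add: "\<And>x y z. h x (y + z) = h x y + h x z"
    and h_scale: "\<And>c x y. h x (c *s y) = c * h x y"
    and h_sym: "\<And>x y. h y x = cnj (h x y)"
  shows "Vector_Spaces.linear (*s) (*s) f \<Longrightarrow> vec.subspace V \<Longrightarrow> f ` V \<subseteq> V \<Longrightarrow>
    (\<And>x. x \<in> V \<Longrightarrow> x \<noteq> 0 \<Longrightarrow> Re (h x (f x)) < 0) \<Longrightarrow> y \<in> V \<Longrightarrow> y \<noteq> 0 \<Longrightarrow> Re (h y y) \<le> 0 \<Longrightarrow>
    \<exists>z. \<exists>v\<in>V. v \<noteq> 0 \<and> f v = z *s v \<and> 0 \<le> Re z"
proof (induction "vec.dim V" arbitrary: V f y rule: less_induct)
  case less
  note f = less.prems(1) and V = less.prems(2) and fV = less.prems(3) and neg = less.prems(4)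
    and y = less.prems(5-7)
  have h0: "h x 0 = 0" for x using h_scale[of x 0 0] by simp
  have h_add': "h (x + y) z = h x z + h y z" for x y z
    unfolding h_sym[of "x + y" z] h_sym[of x z] h_sym[of y z] h_add by simp
  have h_scale': "h (c *s x) z = cnj c * h x z" for c x z
    unfolding h_sym[of "c *s x" z] h_sym[of x z] h_scale by simp
  have h_diff: "h x (y - z) = h x y - h x z" for x y z
    using h_add[of x "y - z" z] by simp
  note hs = h_add h_scale h_add' h_scale' h0 h_diff
  have hreal: "h x x = of_real (Re (h x x))" for x
    using h_sym[of x x] by (simp add: complex_eq_iff)
  note f_simps = op_simps[OF f]
  obtain z v where v: "v \<in> V" "v \<noteq> 0" "f v = z *s v"
    using exists_eigenvector[OF f V fV y(1,2)] by blast
  show ?case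
  proof (cases "0 \<le> Re z")
    case True
    with v show ?thesis by blast
  next
    case False
    \<comment> \<open>The product of \<open>Re z < 0\<close> with \<open>Re (h v v)\<close> is
      negative by hypothesis, which fixes the sign of \<open>h v v\<close>.\<close>
    have "h v (f v) = z * of_real (Re (h v v))" using v hreal[of v] by (simp add: h_scale)
    then have "Re (h v (f v)) = Re z * Re (h v v)" by simp
    with neg[OF v(1,2)] False have hv: "Re (h v v) > 0" by (simp add: mult_less_0_iff)
    then have hv0: "h v v \<noteq> 0" by auto
    define W where "W = {x\<in>V. h v x = 0}"
    have W: "vec.subspace W"
      using V by (auto simp: W_def vec.subspace_def hs)
    define g where "g x = f x - (h v (f x) / h v v) *s v" for x
    have g: "Vector_Spaces.linear (*s) (*s) g"
      by unfold_locales
        (simp_all add: g_def f_simps hs add_divide_distrib vec.scale_left_distrib vec.scale_right_diff_distrib)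
    have gW: "g ` W \<subseteq> W"
      using V fV v hv0 by (auto simp: g_def W_def hs intro: vec.subspace_diff vec.subspace_scale)
    have "v \<notin> W" using hv0 by (simp add: W_def)
    then have "W \<subset> V" using v(1) unfolding W_def by blast
    then have "vec.dim W < vec.dim V"
      using V W by (intro vec.dim_psubset) (metis vec.span_eq_iff)
    moreover have "Re (h x (g x)) < 0" if x: "x \<in> W" "x \<noteq> 0" for x
    proof -
      have "h x v = 0" using x(1) h_sym[of v x] by (simp add: W_def)
      then have "h x (g x) = h x (f x)" by (simp add: g_def hs)
      then show ?thesis using neg[of x] x by (simp add: W_def)
    qed
    \<comment> \<open>The induction needs a nonzero vector in \<open>W\<close> on which the form is
      not positive. The \<open>h\<close>-projection \<open>w\<close> of \<open>y\<close> is one: by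
      Pythagoras, removing the \<open>v\<close>-component can only lower the value of the form, and
      \<open>w = 0\<close> would make \<open>h y y\<close> positive.\<close>
    moreover define c where "c = h v y / h v v"
    define w where "w = y - c *s v"
    have w: "w \<in> W" using V v(1) y(1) hv0
      by (auto simp: w_def W_def c_def hs intro: vec.subspace_diff vec.subspace_scale)
    have yw: "y = c *s v + w" by (simp add: w_def)
    have "h w v = 0" "h v w = 0" using w h_sym[of v w] by (auto simp: W_def)
    then have "h y y = (c * cnj c) * h v v + h w w" unfolding yw by (simp add: hs)
    then have hyy: "Re (h y y) = (cmod c)\<^sup>2 * Re (h v v) + Re (h w w)"
      by (simp add: complex_norm_square[symmetric])
    then have hw: "Re (h w w) \<le> 0" using y(3) hv by (smt (verit) mult_nonneg_nonneg zero_le_power2)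
    have "w \<noteq> 0"
    proof
      assume "w = 0"
      then have "c \<noteq> 0" using yw y(2) by auto
      then have "Re (h y y) > 0" using hyy hv \<open>w = 0\<close> by (simp add: h0)
      with y(3) show False by simp
    qed
    ultimately obtain z' x where x: "x \<in> W" "x \<noteq> 0" "g x = z' *s x" "0 \<le> Re z'"
      using less.hyps[OF _ g W gW _ w _ hw] by blast
    define d where "d = h v (f x) / h v v"
    have fx: "f x = z' *s x + d *s v" using x(3) unfolding g_def d_def[symmetric]
      by (simp add: algebra_simps)
    \<comment> \<open>On the span of \<open>v\<close> and \<open>x\<close> the map \<open>f\<close>
      is triangular with diagonal \<open>z\<close>, \<open>z'\<close>. This \<open>t\<close> solves
      \<open>d + t * z = z' * t\<close>, and the denominator is nonzero because
      \<open>Re z < 0 \<le> Re z'\<close>.\<close>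
    define t where "t = d / (z' - z)"
    have "z' \<noteq> z" using x(4) False by auto
    then have "d + t * z = z' * t" by (simp add: t_def field_simps)
    then have "f (x + t *s v) = z' *s (x + t *s v)"
      by (simp add: f_simps fx v(3) vec.scale_right_distrib add.assoc flip: vec.scale_left_distrib)
    moreover have "x + t *s v \<noteq> 0"
    proof
      assume "x + t *s v = 0"
      then have "h v (x + t *s v) = 0" by (simp add: h0)
      then have "t = 0" using x(1) hv0 by (simp add: hs W_def)
      with \<open>x + t *s v = 0\<close> x(2) show False by simp
    qed
    moreover have "x + t *s v \<in> V"
      using x(1) v(1) V by (auto simp: W_def intro: vec.subspace_add vec.subspace_scale)
    ultimately show ?thesis using x(4) by blast
  qed
qed

subsection \<open>Hermitian matrices\<close>

definition hermitian :: "complex^'m^'m \<Rightarrow> bool" where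
  "hermitian M \<longleftrightarrow> (\<forall>i j. M $ i $ j = cnj (M $ j $ i))"

text \<open>Conjugate-linear in the first argument; the real part is the inner product of the
  underlying real space.\<close>

definition cdot :: "complex^'m \<Rightarrow> complex^'m \<Rightarrow> complex" where
  "cdot x y = (\<Sum>i\<in>UNIV. cnj (x $ i) * y $ i)"

lemma cdot_add: "cdot x (y + z) = cdot x y + cdot x z"
  and cdot_scale: "cdot x (c *s y) = c * cdot x y"
  and cdot_sym: "cdot y x = cnj (cdot x y)"
  by (simp_all add: cdot_def algebra_simps sum.distrib sum_distrib_left)

lemma cdot_eq_inner: "cdot x y = Complex (x \<bullet> y) ((\<i> *s x) \<bullet> y)"
  by (simp add: complex_eq_iff cdot_def inner_vec_def inner_complex_def)

lemma scaleR_eq_scale: "r *\<^sub>R (x :: complex^'m) = complex_of_real r *s x"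
  by (simp add: vec_eq_iff scaleR_conv_of_real[where 'a = complex])

lemma inner_scale_left: "(c *s x) \<bullet> y = x \<bullet> (cnj c *s (y :: complex^'m))"
  by (simp add: inner_vec_def inner_complex_def algebra_simps)

lemma norm_scale: "norm (c *s (x :: complex^'m)) = cmod c * norm x"
  by (simp add: norm_vec_def norm_mult L2_set_right_distrib)

lemma hermitian_selfadjoint:
  assumes "hermitian M"
  shows "selfadjoint ((*v) M)"
  unfolding selfadjoint_def
proof (intro conjI allI)
  show "linear ((*v) M)" by (simp add: linear_linear)
  fix x y
  have "cdot (M *v x) y = (\<Sum>i\<in>UNIV. \<Sum>j\<in>UNIV. cnj (M $ i $ j) * cnj (x $ j) * y $ i)"
    by (simp add: cdot_def matrix_vector_mult_def sum_distrib_right)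
  also have "\<dots> = (\<Sum>j\<in>UNIV. \<Sum>i\<in>UNIV. cnj (M $ i $ j) * cnj (x $ j) * y $ i)"
    by (rule sum.swap)
  also have "\<dots> = (\<Sum>j\<in>UNIV. \<Sum>i\<in>UNIV. cnj (x $ j) * (M $ j $ i * y $ i))"
  proof (intro sum.cong refl)
    fix i j
    have "cnj (M $ i $ j) = M $ j $ i" using assms unfolding hermitian_def by metis
    then show "cnj (M $ i $ j) * cnj (x $ j) * y $ i = cnj (x $ j) * (M $ j $ i * y $ i)" by simp
  qed
  also have "\<dots> = cdot x (M *v y)"
    by (simp add: cdot_def matrix_vector_mult_def sum_distrib_left)
  finally show "(M *v x) \<bullet> y = x \<bullet> (M *v y)" by (simp add: cdot_eq_inner)
qed

lemma eigenbasis_eigenvalue_in_spectrum: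
  assumes "eigenbasis ((*v) M) E L" "e \<in> E"
  shows "complex_of_real (L e) \<in> spectrum M"
proof -
  have "M *v e = complex_of_real (L e) *s e" "e \<bullet> e = 1"
    using assms by (auto simp: eigenbasis_def scaleR_eq_scale)
  then show ?thesis unfolding spectrum_def spectrum_on_def by (auto intro!: exI[of _ e])
qed

lemma hermitian_norm_le:
  assumes M: "hermitian M" and w: "\<And>l. complex_of_real l \<in> spectrum M \<Longrightarrow> \<bar>l\<bar> \<le> w"
  shows "norm (M *v x) \<le> w * norm x"
proof -
  have sa: "selfadjoint ((*v) M)" by (rule hermitian_selfadjoint[OF M])
  obtain E L where eb: "eigenbasis ((*v) M) E L" using selfadjoint_eigenbasis[OF sa] .
  have "(norm (M *v x))\<^sup>2 = (\<Sum>e\<in>E. (L e)\<^sup>2 * (e \<bullet> x)\<^sup>2)"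
    unfolding power2_norm_eq_inner eb_inner[OF sa eb, of "M *v x" "M *v x"]
    by (intro sum.cong) (auto simp: eb_op[OF sa eb] power2_eq_square)
  also have "\<dots> \<le> (\<Sum>e\<in>E. w\<^sup>2 * (e \<bullet> x)\<^sup>2)"
  proof (intro sum_mono mult_right_mono)
    fix e assume "e \<in> E"
    then have "\<bar>L e\<bar> \<le> w" using eigenbasis_eigenvalue_in_spectrum[OF eb] w by blast
    then show "(L e)\<^sup>2 \<le> w\<^sup>2" using power_mono[of "\<bar>L e\<bar>" w 2] by simp
  qed simp
  also have "\<dots> = (w * norm x)\<^sup>2"
    unfolding power_mult_distrib power2_norm_eq_inner eb_inner[OF sa eb, of x x]
    by (simp add: sum_distrib_left power2_eq_square)
  finally have le: "(norm (M *v x))\<^sup>2 \<le> (w * norm x)\<^sup>2" .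
  \<comment> \<open>Taking square roots needs \<open>0 \<le> w\<close>. The hypothesis on
    \<open>w\<close> yields this once there is an eigenvalue, so a nonzero vector is used to see
    that \<open>E\<close> is not empty.\<close>
  have "axis undefined 1 \<noteq> (0 :: complex^'a)" by (simp add: axis_eq_0_iff)
  then obtain e where "e \<in> E" using eb_eqI[OF sa eb, of "axis undefined 1" 0] by blast
  then have "\<bar>L e\<bar> \<le> w" using eigenbasis_eigenvalue_in_spectrum[OF eb] w by blast
  then have "0 \<le> w" by linarith
  then show ?thesis using power2_le_imp_le[OF le] by simp
qed

text \<open>The complex product of \<open>x\<close> with \<open>M *v x\<close> is real, so after
  multiplication by \<open>\<i>\<close> its real part vanishes. This is why the undamped part does
  not contribute to imaginary parts of eigenvalues.\<close>

lemma hermitian_inner_i: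
  assumes "hermitian M"
  shows "x \<bullet> (\<i> *s (M *v x)) = 0"
proof -
  have "x \<bullet> (\<i> *s (M *v x)) = (M *v x) \<bullet> (\<i> *s x)"
    using hermitian_selfadjoint[OF assms] by (simp add: selfadjoint_def vec.scale)
  also have "\<dots> = - (x \<bullet> (\<i> *s (M *v x)))"
    by (subst inner_commute) (simp add: inner_scale_left)
  finally show ?thesis by simp
qed

text \<open>\<open>Om\<close> is a bounded perturbation of - \<i> \<beta> B: for an eigenvector, z v
  + \<i> \<beta> B v equals \<open>Om *v v\<close>, and if z were farther than \<open>w\<close> from
  every - \<i> \<beta> b, the left side would be longer than \<open>w * norm v\<close>.\<close>

lemma damped_eigenvalue_near:
  assumes Om: "\<And>x. norm (Om *v x) \<le> w * norm x" and B: "hermitian B"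
    and v: "v \<noteq> 0" "Om *v v - (\<i> * complex_of_real \<beta>) *s (B *v v) = z *s v"
  shows "\<exists>b. complex_of_real b \<in> spectrum B \<and> cmod (z + \<i> * complex_of_real \<beta> * complex_of_real b) \<le> w"
proof (rule ccontr)
  assume *: "\<not> ?thesis"
  have sa: "selfadjoint ((*v) B)" by (rule hermitian_selfadjoint[OF B])
  obtain E L where eb: "eigenbasis ((*v) B) E L" using selfadjoint_eigenbasis[OF sa] .
  have cm: "(cmod (z + \<i> * complex_of_real \<beta> * complex_of_real l))\<^sup>2
      = (cmod z)\<^sup>2 + \<beta>\<^sup>2 * l\<^sup>2 + 2 * \<beta> * Im z * l" for l
    by (simp add: cmod_power2) (simp add: power2_eq_square algebra_simps)
  define u where "u = z *s v + (\<i> * complex_of_real \<beta>) *s (B *v v)"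
  have "Om *v v = u" using v(2) by (simp add: u_def algebra_simps)
  then have "norm u \<le> w * norm v" using Om[of v] by simp
  then have "(norm u)\<^sup>2 \<le> (w * norm v)\<^sup>2" by (simp add: power_mono)
  \<comment> \<open>\<open>E\<close> is only a real basis, so the coefficients of
    \<open>z *s v\<close> are not multiples of those of \<open>v\<close>. The square is therefore
    first expanded into \<open>norm v\<close>, \<open>norm (B *v v)\<close> and
    \<open>v \<bullet> (B *v v)\<close>, which do have diagonal expansions; the remaining cross term
    vanishes since \<open>B\<close> is Hermitian.\<close>
  also have "(norm u)\<^sup>2 = (cmod z)\<^sup>2 * (norm v)\<^sup>2 + \<beta>\<^sup>2 * (norm (B *v v))\<^sup>2 + 2 * \<beta> * Im z * (v \<bullet> (B *v v))"
  proof -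
    have "cnj z * (\<i> * of_real \<beta>) = of_real (\<beta> * Im z) + \<i> * of_real (\<beta> * Re z)"
      by (simp add: complex_eq_iff)
    then have "(z *s v) \<bullet> ((\<i> * complex_of_real \<beta>) *s (B *v v))
      = (v \<bullet> (complex_of_real (\<beta> * Im z) *s (B *v v)) + v \<bullet> (complex_of_real (\<beta> * Re z) *s (\<i> *s (B *v v))))"
      by (simp add: inner_scale_left vec.scale_left_distrib inner_add_right mult.commute)
    also have "\<dots> = \<beta> * Im z * (v \<bullet> (B *v v))"
      using hermitian_inner_i[OF B, of v] unfolding scaleR_eq_scale[symmetric] by simp
    finally show ?thesis
      unfolding u_def power2_norm_eq_inner inner_add_left inner_add_right
      by (simp add: inner_commute[of "(\<i> * complex_of_real \<beta>) *s (B *v v)" "z *s v"]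
        dot_square_norm norm_scale norm_mult power_mult_distrib)
  qed
  also have "\<dots> = (\<Sum>e\<in>E. (cmod (z + \<i> * complex_of_real \<beta> * complex_of_real (L e)))\<^sup>2 * (e \<bullet> v)\<^sup>2)"
    unfolding power2_norm_eq_inner[of v] power2_norm_eq_inner[of "B *v v"] eb_inner[OF sa eb, of v v] eb_inner[OF sa eb, of "B *v v" "B *v v"]
      eb_inner[OF sa eb, of v "B *v v"]
      sum_distrib_left sum.distrib[symmetric]
    by (intro sum.cong) (simp_all add: eb_op[OF sa eb] cm, simp add: power2_eq_square algebra_simps)
  finally have "(\<Sum>e\<in>E. (cmod (z + \<i> * complex_of_real \<beta> * complex_of_real (L e)))\<^sup>2 * (e \<bullet> v)\<^sup>2)
      \<le> (\<Sum>e\<in>E. w\<^sup>2 * (e \<bullet> v)\<^sup>2)"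
    unfolding power_mult_distrib power2_norm_eq_inner eb_inner[OF sa eb, of v v]
    by (simp add: sum_distrib_left power2_eq_square)
  moreover have "w\<^sup>2 < (cmod (z + \<i> * complex_of_real \<beta> * complex_of_real (L e)))\<^sup>2" if "e \<in> E" for e
  proof (rule power_strict_mono)
    show "w < cmod (z + \<i> * complex_of_real \<beta> * complex_of_real (L e))"
      using * eigenbasis_eigenvalue_in_spectrum[OF eb that] by force
    have "0 \<le> w * norm v" using Om[of v] norm_ge_zero order_trans by blast
    then show "0 \<le> w" using v(1) by (simp add: zero_le_mult_iff)
  qed simp
  note lt = this
  obtain e where e: "e \<in> E" "e \<bullet> v \<noteq> 0"
    using eb_eqI[OF sa eb, of v 0] v(1) by auto
  have "(\<Sum>e\<in>E. w\<^sup>2 * (e \<bullet> v)\<^sup>2)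
      < (\<Sum>e\<in>E. (cmod (z + \<i> * complex_of_real \<beta> * complex_of_real (L e)))\<^sup>2 * (e \<bullet> v)\<^sup>2)"
  proof (rule sum_strict_mono_ex1)
    show "finite E" using eb by (simp add: eigenbasis_def)
    show "\<forall>x\<in>E. w\<^sup>2 * (x \<bullet> v)\<^sup>2 \<le> (cmod (z + \<i> * complex_of_real \<beta> * complex_of_real (L x)))\<^sup>2 * (x \<bullet> v)\<^sup>2"
      by (intro ballI mult_right_mono less_imp_le[OF lt]) auto
    show "\<exists>a\<in>E. w\<^sup>2 * (a \<bullet> v)\<^sup>2 < (cmod (z + \<i> * complex_of_real \<beta> * complex_of_real (L a)))\<^sup>2 * (a \<bullet> v)\<^sup>2"
      using e lt by (intro bexI[of _ e] mult_strict_right_mono) auto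
  qed
  ultimately show False by linarith
qed

lemma damped_eigenvalue_exists:
  assumes Om: "\<And>x. norm (Om *v x) \<le> w * norm x" and B: "hermitian B"
    and b: "\<And>l. complex_of_real l \<in> spectrum B \<Longrightarrow> l = 0 \<or> b \<le> l" "b > 0"
    and \<beta>: "\<beta> \<ge> 0" "\<beta> * b > 2 * w" and x0: "B *v x0 \<noteq> 0"
  shows "\<exists>z v. v \<noteq> 0 \<and> Om *v v - (\<i> * complex_of_real \<beta>) *s (B *v v) = z *s v \<and> - Im z \<ge> \<beta> * b / 2"
proof -
  have sa: "selfadjoint ((*v) B)" by (rule hermitian_selfadjoint[OF B])
  obtain E L where eb: "eigenbasis ((*v) B) E L" using selfadjoint_eigenbasis[OF sa] .
  define s :: "real \<Rightarrow> real" where "s l = (if l = 0 then 1 else -1)" for l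
  define H where "H = fun_calc E L s"
  \<comment> \<open>The balance point: in the form given by \<open>H\<close>, an eigenvector of
    \<open>B\<close> for 0 contributes - \<gamma>, and one for l \<ge> b contributes \<gamma> -
    \<beta> l, which is at most - \<gamma> because 2 \<gamma> = \<beta> b. Since \<open>H\<close> is
    isometric, \<open>Om\<close> adds at most \<open>w\<close>, which is below \<gamma>.\<close>
  define \<gamma> where "\<gamma> = \<beta> * b / 2"
  define f where "f x = \<i> *s (Om *v x - (\<i> * complex_of_real \<beta>) *s (B *v x)) - complex_of_real \<gamma> *s x" for x
  have saH: "selfadjoint H" unfolding H_def by (rule selfadjoint_fun_calc[OF sa eb])
  then have linH: "linear H" and H_sa: "H x \<bullet> y = x \<bullet> H y" for x y by (auto simp: selfadjoint_def)
  have eH: "e \<bullet> H x = s (L e) * (e \<bullet> x)" if "e \<in> E" for e x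
    unfolding H_def using that by (rule eb_calc[OF sa eb])
  have "linear (\<lambda>x. \<i> *s (x :: complex^'a))"
    by (rule linearI) (simp_all add: vec.scale_right_distrib scaleR_eq_scale mult.commute)
  then have H_i: "H (\<i> *s x) = \<i> *s H x" for x
    unfolding H_def by (rule fun_calc_commute[OF sa eb]) (simp add: vec.scale)
  have H_scale: "H (c *s x) = c *s H x" for c x
  proof -
    have "c *s y = Re c *\<^sub>R y + Im c *\<^sub>R (\<i> *s y)" for y :: "complex^'a"
      by (simp add: vec_eq_iff complex_eq_iff)
    then show ?thesis by (simp add: linear_add[OF linH] linear_scale[OF linH] H_i)
  qed
  have normH: "norm (H x) = norm x" for x
  proof -
    have "H x \<bullet> H x = x \<bullet> x"
      unfolding eb_inner[OF sa eb, of "H x" "H x"] eb_inner[OF sa eb, of x x] by (intro sum.cong) (auto simp: eH s_def)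
    then show ?thesis by (simp add: norm_eq_sqrt_inner)
  qed
  have linf: "Vector_Spaces.linear (*s) (*s) f"
    by unfold_locales (simp_all add: f_def vec.add vec.scale vec.scale_right_distrib vec.scale_right_diff_distrib algebra_simps)
  have neg: "Re (cdot x (H (f x))) < 0" if x: "x \<noteq> 0" for x
  proof -
    have fx: "f x = \<i> *s (Om *v x) + (\<beta> *\<^sub>R (B *v x) - \<gamma> *\<^sub>R x)"
      by (simp add: f_def scaleR_eq_scale vec.scale_right_diff_distrib)
    have "H x \<bullet> (\<i> *s (Om *v x)) \<le> norm (H x) * norm (\<i> *s (Om *v x))" by (rule norm_cauchy_schwarz)
    also have "\<dots> \<le> w * (norm x)\<^sup>2"
      using mult_left_mono[OF Om[of x], of "norm x"] by (simp add: normH norm_scale power2_eq_square algebra_simps)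
    finally have 1: "H x \<bullet> (\<i> *s (Om *v x)) \<le> w * (norm x)\<^sup>2" .
    have "H x \<bullet> (\<beta> *\<^sub>R (B *v x) - \<gamma> *\<^sub>R x) = (\<Sum>e\<in>E. s (L e) * (\<beta> * L e - \<gamma>) * (e \<bullet> x)\<^sup>2)"
      unfolding eb_inner[OF sa eb, of "H x"]
      by (intro sum.cong) (auto simp: eH inner_diff_right eb_op[OF sa eb] power2_eq_square algebra_simps)
    also have "\<dots> \<le> (\<Sum>e\<in>E. - \<gamma> * (e \<bullet> x)\<^sup>2)"
    proof (intro sum_mono mult_right_mono)
      fix e assume "e \<in> E"
      then have "L e = 0 \<or> b \<le> L e" using eigenbasis_eigenvalue_in_spectrum[OF eb] b(1) by blast
      then show "s (L e) * (\<beta> * L e - \<gamma>) \<le> - \<gamma>"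
        using mult_left_mono[of b "L e" \<beta>] \<beta>(1) by (auto simp: s_def \<gamma>_def)
    qed simp
    also have "\<dots> = - \<gamma> * (norm x)\<^sup>2"
      unfolding power2_norm_eq_inner eb_inner[OF sa eb, of x x] by (simp add: sum_distrib_left power2_eq_square)
    finally have "H x \<bullet> f x \<le> (w - \<gamma>) * (norm x)\<^sup>2"
      using 1 by (simp add: fx inner_add_right algebra_simps)
    also have "\<dots> < 0" using x \<beta> by (simp add: \<gamma>_def mult_less_0_iff)
    finally show ?thesis by (simp add: cdot_eq_inner H_sa)
  qed
  obtain e where e: "e \<in> E" "L e \<noteq> 0"
  proof -
    have "\<exists>e\<in>E. e \<bullet> (B *v x0) \<noteq> 0"
      using eb_eqI[OF sa eb, of "B *v x0" 0] x0 by auto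
    then show thesis using that by (auto simp: eb_op[OF sa eb])
  qed
  have "e \<bullet> e = 1" "B *v e = L e *\<^sub>R e" using eb e by (auto simp: eigenbasis_def)
  moreover from this have "H e = s (L e) *\<^sub>R e" unfolding H_def by (intro fun_calc_eigen[OF sa eb])
  ultimately have he: "Re (cdot e (H e)) \<le> 0" "e \<noteq> 0" using e(2) by (auto simp: cdot_eq_inner s_def)
  have "\<exists>z. \<exists>v\<in>UNIV. v \<noteq> 0 \<and> f v = z *s v \<and> 0 \<le> Re z"
  proof (rule exists_eigenvalue_Re_nonneg[where h = "\<lambda>x y. cdot x (H y)"])
    show "cdot y (H x) = cnj (cdot x (H y))" for x y
      unfolding cdot_sym[of "H y" x, symmetric]
      by (simp add: cdot_eq_inner H_sa flip: H_i)
  qed (use linf neg he in \<open>auto simp: linear_add[OF linH] cdot_add H_scale cdot_scale\<close>)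
  then obtain z v where v: "v \<noteq> 0" "f v = z *s v" "0 \<le> Re z" by blast
  define A where "A = Om *v v - (\<i> * complex_of_real \<beta>) *s (B *v v)"
  have "\<i> *s A = (z + of_real \<gamma>) *s v"
    using v(2) unfolding f_def A_def[symmetric] by (simp add: vec.scale_left_distrib algebra_simps)
  \<comment> \<open>Undoes the rotation and shift in \<open>f\<close>: minus the imaginary part of
    the resulting eigenvalue is \<open>Re z + \<gamma>\<close>, which is at least
    \<open>\<gamma>\<close>.\<close>
  then have "(- \<i>) *s (\<i> *s A) = (- \<i>) *s ((z + of_real \<gamma>) *s v)" by simp
  then have "A = (- \<i> * (z + of_real \<gamma>)) *s v" by (simp only: vec.scale_scale) simp
  then show ?thesis using v unfolding A_def by (intro exI[of _ "- \<i> * (z + of_real \<gamma>)"] exI[of _ v]) (simp add: \<gamma>_def)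
qed

subsection \<open>The block operator and its quadratic pencil\<close>

abbreviation cmat :: "real^'n^'n \<Rightarrow> complex^'n^'n" where
  "cmat \<equiv> cscale 1"

definition bvec :: "complex^'n \<Rightarrow> complex^'n \<Rightarrow> complex^('n + 'n)" where
  "bvec x y = (\<chi> i. case i of Inl k \<Rightarrow> x $ k | Inr k \<Rightarrow> y $ k)"

lemma sum_UNIV_Plus: "(\<Sum>i\<in>UNIV. f i) = (\<Sum>k\<in>UNIV. f (Inl k)) + (\<Sum>k\<in>UNIV. f (Inr k))"
  for f :: "'a::finite + 'b::finite \<Rightarrow> 'c::comm_monoid_add"
  unfolding UNIV_Plus_UNIV[symmetric] by (subst sum.Plus) simp_all

lemma bvec_cases: obtains x y where "v = bvec x y"
  by (rule that[of "\<chi> k. v $ Inl k" "\<chi> k. v $ Inr k"])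
    (auto simp: bvec_def vec_eq_iff split: sum.split)

lemma bvec_eq_iff: "bvec x y = bvec x' y' \<longleftrightarrow> x = x' \<and> y = y'"
proof
  assume *: "bvec x y = bvec x' y'"
  have "x $ k = x' $ k \<and> y $ k = y' $ k" for k
    using arg_cong[OF *, of "\<lambda>v. v $ Inl k"] arg_cong[OF *, of "\<lambda>v. v $ Inr k"] by (simp add: bvec_def)
  then show "x = x' \<and> y = y'" by (simp add: vec_eq_iff)
qed simp

lemma bvec_0: "bvec 0 0 = 0"
  by (auto simp: bvec_def vec_eq_iff split: sum.split)

lemma bvec_diff: "bvec x y - bvec x' y' = bvec (x - x') (y - y')"
  by (auto simp: bvec_def vec_eq_iff split: sum.split)

lemma bvec_scale: "c *s bvec x y = bvec (c *s x) (c *s y)"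
  by (auto simp: bvec_def vec_eq_iff split: sum.split)

lemma inner_bvec: "bvec x y \<bullet> bvec x' y' = x \<bullet> x' + y \<bullet> y'"
  by (simp add: inner_vec_def sum_UNIV_Plus bvec_def)

lemma block_matrix_bvec:
  "block_matrix P Q S T *v bvec x y = bvec (P *v x + Q *v y) (S *v x + T *v y)"
  by (auto simp: matrix_vector_mult_def block_matrix_def bvec_def vec_eq_iff sum_UNIV_Plus split: sum.split)

lemma cscale_vec: "cscale c M *v x = c *s (cmat M *v x)"
  by (simp add: cscale_def matrix_vector_mult_def vec_eq_iff map_matrix_def sum_distrib_left mult.assoc)

lemma map_matrix_scale_vec: "map_matrix (\<lambda>z. c * z) M *v x = c *s (M *v x)"
  by (simp add: matrix_vector_mult_def vec_eq_iff map_matrix_def sum_distrib_left mult.assoc)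

lemma cmat_mult: "cmat (M ** N) = cmat M ** cmat N"
  by (simp add: cscale_def matrix_matrix_mult_def vec_eq_iff map_matrix_def)

lemma cmat_mult_vec: "cmat (M ** N) *v x = cmat M *v (cmat N *v x)"
  by (simp add: cmat_mult matrix_vector_mul_assoc)

lemma cmat_1_vec: "cmat (mat 1) *v x = x" for x :: "complex^'n"
proof -
  have "cmat (mat 1) = (mat 1 :: complex^'n^'n)"
    by (simp add: cscale_def mat_def vec_eq_iff map_matrix_def)
  then show ?thesis by simp
qed

text \<open>A real matrix acts separately on real and imaginary parts, and the real inner product is
  the sum over the two.\<close>

lemma cmat_inner_nonneg:
  assumes "psd M"
  shows "0 \<le> q \<bullet> (cmat M *v q)"
proof -
  let ?u = "\<chi> i. Re (q $ i)" and ?v = "\<chi> i. Im (q $ i)"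
  have "q \<bullet> (cmat M *v q) = ?u \<bullet> (M *v ?u) + ?v \<bullet> (M *v ?v)"
    by (simp add: inner_vec_def inner_complex_def matrix_vector_mult_def cscale_def map_matrix_def sum.distrib)
  then show ?thesis using assms by (simp add: psd_def)
qed

lemma matrix_mult_minus:
  fixes M N :: "real^'n^'n"
  shows "M ** (- N) = - (M ** N)" "(- M) ** N = - (M ** N)"
  by (simp_all add: matrix_matrix_mult_def vec_eq_iff sum_negf)

definition cnj_vec :: "complex^'n \<Rightarrow> complex^'n" where
  "cnj_vec x = (\<chi> i. cnj (x $ i))"

lemma cnj_vec_simps:
  "cnj_vec (x + y) = cnj_vec x + cnj_vec y" "cnj_vec (c *s x) = cnj c *s cnj_vec x"
  "cnj_vec (cmat M *v x) = cmat M *v cnj_vec x" "cnj_vec x = 0 \<longleftrightarrow> x = 0"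
  by (simp_all add: cnj_vec_def vec_eq_iff matrix_vector_mult_def cscale_def map_matrix_def)

lemma Amat_vec: "Amat \<alpha> \<eta> \<theta> R \<beta> *v v
    = Omega \<alpha> \<eta> \<theta> *v v - (\<i> * complex_of_real \<beta>) *s (Bmat \<alpha> R *v v)"
  by (simp add: Amat_def matrix_vector_mult_diff_rdistrib map_matrix_scale_vec)

lemma Amat_0: "Amat \<alpha> \<eta> \<theta> R 0 = Omega \<alpha> \<eta> \<theta>"
  by (simp add: Amat_def map_matrix_def vec_eq_iff)

text \<open>With both \<open>\<alpha>\<close> and \<open>\<eta>\<close> positive definite the
  assumptions are symmetric in the two, so the dual system is an instance of the same locale and
  each result is available for both.\<close>

locale damped_system =
  fixes \<alpha> \<eta> \<theta> R :: "real^'n^'n"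
  assumes pos_\<alpha>: "pos_def \<alpha>" and pos_\<eta>: "pos_def \<eta>" and skew: "transpose \<theta> = - \<theta>" and psd_R: "psd R"
    and rank_R: "rank R > 0"
begin

abbreviation "A \<equiv> Amat \<alpha> \<eta> \<theta> R"
abbreviation "\<Omega> \<equiv> Omega \<alpha> \<eta> \<theta>"
abbreviation "B \<equiv> Bmat \<alpha> R"
abbreviation "a \<equiv> inv_sqrt \<alpha>"
abbreviation "r\<alpha> \<equiv> psd_sqrt \<alpha>"
abbreviation "r\<eta> \<equiv> psd_sqrt \<eta>"

lemmas psd_\<alpha> = pos_def_imp_psd[OF pos_\<alpha>]
lemmas psd_\<eta> = pos_def_imp_psd[OF pos_\<eta>]

lemma sqrt_vec:
  "cmat r\<alpha> *v (cmat a *v x) = x" "cmat a *v (cmat r\<alpha> *v x) = x"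
  "cmat r\<alpha> *v (cmat r\<alpha> *v x) = cmat \<alpha> *v x" "cmat r\<eta> *v (cmat r\<eta> *v x) = cmat \<eta> *v x"
  "cmat r\<eta> *v x = 0 \<longleftrightarrow> x = 0" "cmat a *v x = 0 \<longleftrightarrow> x = 0"
proof -
  show 1: "cmat r\<alpha> *v (cmat a *v x) = x" "cmat a *v (cmat r\<alpha> *v x) = x" for x
    by (simp_all add: inv_sqrt[OF pos_\<alpha>] cmat_1_vec flip: cmat_mult_vec)
  show "cmat r\<alpha> *v (cmat r\<alpha> *v x) = cmat \<alpha> *v x" "cmat r\<eta> *v (cmat r\<eta> *v x) = cmat \<eta> *v x"
    by (simp_all add: psd_sqrt[OF psd_\<alpha>] psd_sqrt[OF psd_\<eta>] flip: cmat_mult_vec)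
  have "cmat (inv_sqrt \<eta>) *v (cmat r\<eta> *v x) = x"
    by (simp_all add: inv_sqrt[OF pos_\<eta>] cmat_1_vec flip: cmat_mult_vec)
  then show "cmat r\<eta> *v x = 0 \<longleftrightarrow> x = 0" by (metis matrix_vector_mult_0_right)
  show "cmat a *v x = 0 \<longleftrightarrow> x = 0" using 1(1)[of x] by (metis matrix_vector_mult_0_right)
qed

lemma eta_vec_zero: "cmat \<eta> *v q = 0 \<longleftrightarrow> q = 0"
  unfolding sqrt_vec(4)[symmetric] sqrt_vec(5) by (rule refl)

lemma Phi_transpose: "transpose (Phi \<alpha> \<eta>) = a ** r\<eta>"
  using psd_sqrt(1)[OF psd_\<eta>]
  by (simp add: Phi_def matrix_transpose_mul inv_sqrt[OF pos_\<alpha>] psd_def)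

lemma Bmat_bvec: "B *v bvec x y = bvec (cmat a *v (cmat R *v (cmat a *v x))) 0"
  by (simp add: Bmat_def block_matrix_bvec cmat_mult_vec)

lemma Omega_bvec: "\<Omega> *v bvec x y =
   bvec ((- 2 * \<i>) *s (cmat a *v (cmat \<theta> *v (cmat a *v x))) - \<i> *s (cmat a *v (cmat r\<eta> *v y)))
     (\<i> *s (cmat r\<eta> *v (cmat a *v x)))"
  by (simp add: Omega_def block_matrix_bvec cmat_mult_vec Phi_transpose[unfolded Phi_def] Phi_def
    cscale_vec[of "- (2 * \<i>)"] cscale_vec[of "- \<i>"] cscale_vec[of \<i>] vec.scale_minus_left)

lemma A_bvec: "A \<beta> *v bvec x y =
   bvec (cmat a *v ((- 2 * \<i>) *s (cmat \<theta> *v (cmat a *v x)) - \<i> *s (cmat r\<eta> *v y)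
      - (\<i> * complex_of_real \<beta>) *s (cmat R *v (cmat a *v x))))
     (\<i> *s (cmat r\<eta> *v (cmat a *v x)))"
  by (simp add: Amat_vec Omega_bvec Bmat_bvec bvec_scale bvec_diff vec.diff vec.scale vec.neg)

text \<open>Eliminating the second block removes all square roots. Only in this form are
  \<open>\<alpha>\<close> and \<open>\<eta>\<close> on an equal footing, and only here is it visible
  that all coefficient matrices are real.\<close>

lemma spectrum_iff_pencil:
  "z \<in> spectrum (A \<beta>) \<longleftrightarrow> (\<exists>q. q \<noteq> 0 \<and> cmat \<eta> *v q
     = z\<^sup>2 *s (cmat \<alpha> *v q) + (2 * \<i> * z) *s (cmat \<theta> *v q) + (\<i> * z * complex_of_real \<beta>) *s (cmat R *v q))"
  (is "_ \<longleftrightarrow> (\<exists>q. q \<noteq> 0 \<and> ?P q)")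
proof
  assume "z \<in> spectrum (A \<beta>)"
  then obtain v where v: "v \<noteq> 0" "A \<beta> *v v = z *s v" by (auto simp: spectrum_def spectrum_on_def)
  obtain x y where xy: "v = bvec x y" by (rule bvec_cases)
  \<comment> \<open>Undoes the scaling of the first block. After multiplying the block rows by
    \<open>r\<alpha>\<close> and \<open>r\<eta>\<close> respectively, \<open>y\<close> enters both
    only through \<open>cmat r\<eta> *v y\<close>, which can then be eliminated.\<close>
  define q where "q = cmat a *v x"
  let ?F = "(- 2 * \<i>) *s (cmat \<theta> *v q) - \<i> *s (cmat r\<eta> *v y) - (\<i> * complex_of_real \<beta>) *s (cmat R *v q)"
  have 1: "cmat a *v ?F = z *s x" and 2: "\<i> *s (cmat r\<eta> *v q) = z *s y"
    using v(2) unfolding xy A_bvec bvec_scale bvec_eq_iff q_def by auto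
  have x: "x = cmat r\<alpha> *v q" by (simp add: q_def sqrt_vec)
  have F: "?F = z *s (cmat \<alpha> *v q)"
    using arg_cong[OF 1, of "(*v) (cmat r\<alpha>)"] by (simp add: sqrt_vec x vec.scale)
  have 3: "\<i> *s (cmat \<eta> *v q) = z *s (cmat r\<eta> *v y)"
    using arg_cong[OF 2, of "(*v) (cmat r\<eta>)"] by (simp add: sqrt_vec vec.scale)
  have "q \<noteq> 0"
  proof
    assume q: "q = 0"
    then have "\<i> *s (cmat r\<eta> *v y) = 0" using F by simp
    then have "y = 0" by (simp add: sqrt_vec)
    moreover have "x = 0" using x q by simp
    ultimately show False using v(1) by (simp add: xy bvec_0)
  qed
  moreover have "?P q"
  proof (simp only: vec_eq_iff, intro allI)
    fix k
    have "\<i> * (cmat \<eta> *v q) $ k = z * (cmat r\<eta> *v y) $ k"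
      using arg_cong[OF 3, of "\<lambda>v. v $ k"] by simp
    moreover have "- 2 * \<i> * (cmat \<theta> *v q) $ k - \<i> * (cmat r\<eta> *v y) $ k - \<i> * complex_of_real \<beta> * (cmat R *v q) $ k
      = z * (cmat \<alpha> *v q) $ k"
      using arg_cong[OF F, of "\<lambda>v. v $ k"] by simp
    ultimately have "\<i> * \<i> * (cmat \<eta> *v q) $ k = - (z * (z * (cmat \<alpha> *v q) $ k)) - 
       z * (2 * \<i> * (cmat \<theta> *v q) $ k) - z * (\<i> * complex_of_real \<beta> * (cmat R *v q) $ k)"
      by algebra
    then show "(cmat \<eta> *v q) $ k = (z\<^sup>2 *s (cmat \<alpha> *v q) + (2 * \<i> * z) *s (cmat \<theta> *v q)
       + (\<i> * z * complex_of_real \<beta>) *s (cmat R *v q)) $ k"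
      by (simp add: power2_eq_square algebra_simps)
  qed
  ultimately show "\<exists>q. q \<noteq> 0 \<and> ?P q" by blast
next
  assume "\<exists>q. q \<noteq> 0 \<and> ?P q"
  then obtain q where q: "q \<noteq> 0" "?P q" by blast
  have z: "z \<noteq> 0"
  proof
    assume "z = 0"
    then have "cmat \<eta> *v q = 0" using q(2) by simp
    with q(1) show False by (simp add: eta_vec_zero)
  qed
  define x where "x = cmat r\<alpha> *v q"
  \<comment> \<open>Forced by the second block row,
    \<open>\<i> *s (cmat r\<eta> *v q) = z *s y\<close>; \<open>z\<close> may be divided out because
    \<open>\<eta>\<close> is positive definite.\<close>
  define y where "y = (\<i> / z) *s (cmat r\<eta> *v q)"
  have ax: "cmat a *v x = q" by (simp add: x_def sqrt_vec)
  have ry: "cmat r\<eta> *v y = (\<i> / z) *s (cmat \<eta> *v q)" by (simp add: y_def vec.scale sqrt_vec)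
  have F: "(- 2 * \<i>) *s (cmat \<theta> *v q) - \<i> *s (cmat r\<eta> *v y) - (\<i> * complex_of_real \<beta>) *s (cmat R *v q)
      = z *s (cmat \<alpha> *v q)"
    unfolding ry q(2) using z by (simp add: vec_eq_iff field_simps power2_eq_square)
  have "cmat a *v (cmat \<alpha> *v q) = x" by (simp add: x_def sqrt_vec(2) flip: sqrt_vec(3))
  then have "A \<beta> *v bvec x y = z *s bvec x y"
    unfolding A_bvec ax F bvec_scale bvec_eq_iff using z by (simp add: vec.scale y_def)
  moreover have "bvec x y \<noteq> 0"
  proof
    assume "bvec x y = 0"
    then have "x = 0" using bvec_eq_iff[of x y 0 0] by (simp add: bvec_0)
    with ax q(1) show False by simp
  qed
  ultimately show "z \<in> spectrum (A \<beta>)" by (auto simp: spectrum_def spectrum_on_def)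
qed

lemma spectrum_nonzero: "0 \<notin> spectrum (A \<beta>)"
proof
  assume "0 \<in> spectrum (A \<beta>)"
  then show False by (auto simp: spectrum_iff_pencil eta_vec_zero)
qed

text \<open>Complex conjugation of the pencil: the matrices are real, and conjugating both
  \<open>\<i> * z\<close> and \<open>z\<^sup>2\<close> amounts to replacing \<open>z\<close> by
  \<open>- cnj z\<close>. For \<beta> = 0 this makes the spectrum of \<open>\<Omega>\<close>
  symmetric about 0.\<close>

lemma spectrum_minus_cnj:
  assumes "z \<in> spectrum (A \<beta>)"
  shows "- cnj z \<in> spectrum (A \<beta>)"
proof -
  from assms obtain q where q: "q \<noteq> 0" "cmat \<eta> *v q
     = z\<^sup>2 *s (cmat \<alpha> *v q) + (2 * \<i> * z) *s (cmat \<theta> *v q) + (\<i> * z * complex_of_real \<beta>) *s (cmat R *v q)"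
    unfolding spectrum_iff_pencil by blast
  show ?thesis unfolding spectrum_iff_pencil
    using q(1) arg_cong[OF q(2), of cnj_vec]
    by (intro exI[of _ "cnj_vec q"]) (simp add: cnj_vec_simps)
qed

lemma hermitian_Omega: "hermitian \<Omega>"
  unfolding hermitian_def
proof (intro allI)
  fix i j :: "'n + 'n"
  let ?X = "a ** \<theta> ** a"
  have "transpose ?X = a ** (- \<theta> ** a)"
    by (simp only: matrix_transpose_mul inv_sqrt(3)[OF pos_\<alpha>] skew)
  also have "\<dots> = - ?X" by (simp only: matrix_mult_minus matrix_mul_assoc)
  finally have "transpose ?X = - ?X" .
  from arg_cong[OF this, of "\<lambda>M. M $ k $ l" for k l]
  have X: "?X $ l $ k = - ?X $ k $ l" for k l
    unfolding transpose_def vec_lambda_beta vector_uminus_component by assumption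
  have 1: "cscale (- 2 * \<i>) ?X $ k $ l = cnj (cscale (- 2 * \<i>) ?X $ l $ k)" for k l
    unfolding cscale_def map_matrix_def vec_lambda_beta X[of l k] by simp
  have 2: "cscale (- \<i>) (transpose P) $ k $ l = cnj (cscale \<i> P $ l $ k)"
    and 3: "cscale \<i> P $ k $ l = cnj (cscale (- \<i>) (transpose P) $ l $ k)" for P :: "real^'n^'n" and k l
    by (simp_all add: cscale_def map_matrix_def transpose_def)
  show "\<Omega> $ i $ j = cnj (\<Omega> $ j $ i)"
    unfolding Omega_def block_matrix_def
    by (cases i; cases j; simp only: vec_lambda_beta sum.case; (rule 1 | rule 2 | rule 3 | simp))
qed

lemma hermitian_B: "hermitian B"
proof -
  let ?X = "a ** R ** a"
  have "transpose ?X = ?X"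
    using psd_R by (simp add: matrix_transpose_mul inv_sqrt[OF pos_\<alpha>] psd_def matrix_mul_assoc) 
  then have "transpose ?X $ k $ l = ?X $ k $ l" for k l by simp
  then have X: "?X $ l $ k = ?X $ k $ l" for k l by (simp add: transpose_def)
  have "cnj (cmat ?X $ l $ k) = cmat ?X $ k $ l" for k l
    using X[of k l] by (simp add: cscale_def map_matrix_def)
  then show ?thesis
    unfolding hermitian_def Bmat_def block_matrix_def by (simp split: sum.split)
qed

lemma cmat_a_inner: "(cmat a *v x) \<bullet> y = x \<bullet> (cmat a *v y)"
proof -
  have "hermitian (cmat a)"
    unfolding hermitian_def cscale_def map_matrix_def
    using inv_sqrt(3)[OF pos_\<alpha>] by (auto simp: transpose_def vec_eq_iff)
  then show ?thesis using hermitian_selfadjoint by (auto simp: selfadjoint_def)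
qed

lemma B_nonneg: "0 \<le> v \<bullet> (B *v v)"
proof -
  obtain x y where v: "v = bvec x y" by (rule bvec_cases)
  show ?thesis unfolding v Bmat_bvec inner_bvec
    using cmat_inner_nonneg[OF psd_R, of "cmat a *v x"] by (simp add: cmat_a_inner)
qed

lemma B_nonzero: "\<exists>v. B *v v \<noteq> 0"
proof -
  have "R \<noteq> 0" using rank_R by (auto simp: rank_0)
  then have "cmat R \<noteq> 0" by (auto simp: cscale_def map_matrix_def vec_eq_iff)
  then obtain q where q: "cmat R *v q \<noteq> 0" by (metis matrix_eq matrix_vector_mult_0)
  have "B *v bvec (cmat r\<alpha> *v q) 0 = bvec (cmat a *v (cmat R *v q)) 0"
    by (simp add: Bmat_bvec sqrt_vec)
  moreover have "\<dots> \<noteq> bvec 0 0" using q by (simp add: bvec_eq_iff sqrt_vec)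
  ultimately show ?thesis by (metis bvec_0)
qed

end

section \<open>Duality under the exchange of \<open>\<alpha>\<close> and
  \<open>\<eta>\<close>\<close>

lemma damped_system_dual: "damped_system \<alpha> \<eta> \<theta> R \<Longrightarrow> damped_system \<eta> \<alpha> \<theta> R"
  by (simp add: damped_system_def)

text \<open>Dividing the pencil by \<open>z\<^sup>2\<close> exchanges the roles of
  \<open>\<alpha>\<close> and \<open>\<eta>\<close>, with the same vector \<open>q\<close>. The
  minus sign in \<open>- 1 / z\<close> preserves the signs of \<open>\<theta>\<close> and
  \<open>R\<close>, so the dual is again a damped system with the same \<beta>.\<close>

lemma spectrum_dual:
  assumes "damped_system \<alpha> \<eta> \<theta> R" "z \<in> spectrum (Amat \<alpha> \<eta> \<theta> R \<beta>)"
  shows "- 1 / z \<in> spectrum (Amat \<eta> \<alpha> \<theta> R \<beta>)"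
proof -
  interpret damped_system \<alpha> \<eta> \<theta> R by fact
  interpret dual: damped_system \<eta> \<alpha> \<theta> R using assms(1) by (rule damped_system_dual)
  have z: "z \<noteq> 0" using spectrum_nonzero assms(2) by auto
  from assms obtain q where q: "q \<noteq> 0" "cmat \<eta> *v q
     = z\<^sup>2 *s (cmat \<alpha> *v q) + (2 * \<i> * z) *s (cmat \<theta> *v q) + (\<i> * z * complex_of_real \<beta>) *s (cmat R *v q)"
    unfolding spectrum_iff_pencil by blast
  show ?thesis unfolding dual.spectrum_iff_pencil
  proof (intro exI[of _ q] conjI q(1))
    show "cmat \<alpha> *v q = (- 1 / z)\<^sup>2 *s (cmat \<eta> *v q) + (2 * \<i> * (- 1 / z)) *s (cmat \<theta> *v q)
      + (\<i> * (- 1 / z) * complex_of_real \<beta>) *s (cmat R *v q)"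
      unfolding q(2) using z by (simp add: vec_eq_iff field_simps power2_eq_square)
  qed
qed

subsection \<open>Location of the spectrum\<close>

lemma inner_scale_self: "v \<bullet> (c *s v) = Re c * (norm v)\<^sup>2" for v :: "complex^'m"
  unfolding power2_norm_eq_inner
  by (simp add: inner_vec_def inner_complex_def sum_distrib_left algebra_simps)

lemma finite_real_spectrum: "finite {l. complex_of_real l \<in> spectrum M}"
  using finite_vimageI[OF finite_spectrum[of M] inj_of_real] by (simp add: vimage_def)

text \<open>The origin of the quantity \<open>- Im z / (cmod z)\<^sup>2\<close> in the theorem: it
  is the damping rate of the dual eigenvalue.\<close>

lemma Im_minus_inverse: "Im (- 1 / z) = Im z / (cmod z)\<^sup>2" and Re_minus_inverse: "Re (- 1 / z) = - Re z / (cmod z)\<^sup>2"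
  by (simp_all add: Re_divide Im_divide cmod_power2)

text \<open>Passing to \<open>- 1 / z\<close> divides the real and imaginary parts by the same
  positive number, up to the sign of the real part.\<close>

lemma Qfactor_minus_inverse: "Qfactor (- 1 / z) = Qfactor z"
proof (cases "z = 0")
  case False
  define u where "u = - 1 / z"
  have u: "Im u = Im z / (cmod z)\<^sup>2" "Re u = - Re z / (cmod z)\<^sup>2" "u \<noteq> 0"
    using False by (simp_all only: u_def Im_minus_inverse Re_minus_inverse) simp
  then have "\<bar>Re u\<bar> / (- Im u) = \<bar>Re z\<bar> / (- Im z)" using False by simp
  then have "Qfactor u = Qfactor z" using u False by (simp add: Qfactor_def)
  then show ?thesis by (simp only: u_def)
qed simp

lemma Qfactor_le:
  assumes "\<bar>Re z\<bar> \<le> w" "d \<le> - Im z" "d > 0"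
  shows "Qfactor z \<le> ereal (1/2 * (w / d))"
proof -
  have "\<bar>Re z\<bar> / (- Im z) \<le> w / d" using assms by (intro frac_le) auto
  then show ?thesis using assms by (auto simp: Qfactor_def)
qed

context damped_system
begin

abbreviation "w \<equiv> omega_max \<alpha> \<eta> \<theta>"
abbreviation "b \<equiv> b_min \<alpha> R"

lemma spectrum_A_eigenvector:
  assumes "z \<in> spectrum (A \<beta>)"
  obtains v where "v \<noteq> 0" "\<Omega> *v v - (\<i> * complex_of_real \<beta>) *s (B *v v) = z *s v"
  using assms by (auto simp: spectrum_def spectrum_on_def Amat_vec)

lemma spectrum_A_I:
  "v \<noteq> 0 \<Longrightarrow> \<Omega> *v v - (\<i> * complex_of_real \<beta>) *s (B *v v) = z *s v \<Longrightarrow> z \<in> spectrum (A \<beta>)"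
  by (auto simp: spectrum_def spectrum_on_def Amat_vec)

text \<open>\<open>c\<close> is the Rayleigh quotient of \<open>B\<close> at an eigenvector. Keeping
  the factor \<beta> explicit lets one statement give both \<open>Im z \<le> 0\<close> for \<beta>
  \<ge> 0 and, at \<beta> = 0, the reality of the spectrum of \<open>\<Omega>\<close>.\<close>

lemma Im_spectrum:
  assumes "z \<in> spectrum (A \<beta>)"
  obtains c where "c \<ge> 0" "- Im z = \<beta> * c"
proof -
  obtain v where v: "v \<noteq> 0" "\<Omega> *v v - (\<i> * complex_of_real \<beta>) *s (B *v v) = z *s v"
    using assms by (rule spectrum_A_eigenvector)
  have "\<i> *s (\<Omega> *v v - (\<i> * complex_of_real \<beta>) *s (B *v v)) = \<i> *s (\<Omega> *v v) + \<beta> *\<^sub>R (B *v v)"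
    by (simp add: vec.scale_right_diff_distrib scaleR_eq_scale)
  then have "v \<bullet> (\<i> *s (\<Omega> *v v) + \<beta> *\<^sub>R (B *v v)) = v \<bullet> ((\<i> * z) *s v)"
    using v(2) by simp
  then have "\<beta> * (v \<bullet> (B *v v)) = - Im z * (norm v)\<^sup>2"
    unfolding inner_add_right inner_scale_self hermitian_inner_i[OF hermitian_Omega] by simp
  then have "- Im z = \<beta> * ((v \<bullet> (B *v v)) / (norm v)\<^sup>2)" using v(1) by (simp add: field_simps)
  then show thesis using B_nonneg[of v] by (intro that[of "(v \<bullet> (B *v v)) / (norm v)\<^sup>2"]) auto
qed

lemma spectrum_Omega_real: "z \<in> spectrum \<Omega> \<Longrightarrow> complex_of_real (Re z) = z"
  using Im_spectrum[of z 0] by (auto simp: Amat_0 complex_eq_iff)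

lemma spectrum_Omega_uminus: "complex_of_real l \<in> spectrum \<Omega> \<Longrightarrow> complex_of_real (- l) \<in> spectrum \<Omega>"
  using spectrum_minus_cnj[of "complex_of_real l" 0] by (simp add: Amat_0)

text \<open>\<open>omega_max\<close> is defined as the largest eigenvalue, not the largest modulus;
  the symmetry of the spectrum under negation makes it a bound for the norm of
  \<open>\<Omega>\<close>.\<close>

lemma spectrum_Omega_le:
  assumes "complex_of_real l \<in> spectrum \<Omega>"
  shows "\<bar>l\<bar> \<le> w"
  using Max_ge[OF finite_real_spectrum, of l \<Omega>] Max_ge[OF finite_real_spectrum, of "- l" \<Omega>]
    assms spectrum_Omega_uminus[OF assms] unfolding omega_max_def by auto

lemma omega_max_in: "complex_of_real w \<in> spectrum \<Omega>"
proof -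
  have "\<exists>z. \<exists>v\<in>UNIV. v \<noteq> 0 \<and> \<Omega> *v v = z *s v"
    by (rule exists_eigenvector[where y = "axis undefined 1"]) (auto simp: axis_eq_0_iff)
  then obtain z where z: "z \<in> spectrum \<Omega>" by (auto simp: spectrum_def spectrum_on_def)
  then have "{l. complex_of_real l \<in> spectrum \<Omega>} \<noteq> {}"
    using z spectrum_Omega_real[OF z] by (metis empty_iff mem_Collect_eq)
  from Max_in[OF finite_real_spectrum this] show ?thesis by (simp add: omega_max_def)
qed

lemma omega_max_pos: "0 < w"
proof -
  have "w \<noteq> 0" using omega_max_in spectrum_nonzero[of 0] by (auto simp: Amat_0)
  moreover have "\<bar>w\<bar> \<le> w" by (rule spectrum_Omega_le[OF omega_max_in])
  ultimately show ?thesis by linarith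
qed

lemma norm_Omega: "norm (\<Omega> *v x) \<le> w * norm x"
  by (rule hermitian_norm_le[OF hermitian_Omega spectrum_Omega_le])

lemma eig_B_nonneg:
  assumes "complex_of_real l \<in> spectrum B"
  shows "0 \<le> l"
proof -
  obtain v where v: "v \<noteq> 0" "B *v v = complex_of_real l *s v"
    using assms by (auto simp: spectrum_def spectrum_on_def)
  have "0 \<le> l * (norm v)\<^sup>2" using B_nonneg[of v] unfolding v(2) inner_scale_self by simp
  then show ?thesis using v(1) by (simp add: zero_le_mult_iff)
qed

lemma finite_nonzero_eigs: "finite (nonzero_eigs_B \<alpha> R)"
  unfolding nonzero_eigs_B_def by (rule finite_subset[OF _ finite_real_spectrum[of B]]) auto

lemma nonzero_eigs_nonempty: "nonzero_eigs_B \<alpha> R \<noteq> {}"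
proof -
  have sa: "selfadjoint ((*v) B)" by (rule hermitian_selfadjoint[OF hermitian_B])
  obtain E L where eb: "eigenbasis ((*v) B) E L" using selfadjoint_eigenbasis[OF sa] .
  obtain v where "B *v v \<noteq> 0" using B_nonzero by blast
  then obtain e where "e \<in> E" "e \<bullet> (B *v v) \<noteq> 0"
    using eb_eqI[OF sa eb, of "B *v v" 0] by auto
  then show ?thesis
    using eb_op[OF sa eb, of e v] eigenbasis_eigenvalue_in_spectrum[OF eb, of e]
    by (auto simp: nonzero_eigs_B_def)
qed

lemma b_min_le: "l \<in> nonzero_eigs_B \<alpha> R \<Longrightarrow> b \<le> l"
  unfolding b_min_def by (rule Min_le[OF finite_nonzero_eigs])

lemma b_min_pos: "0 < b"
proof -
  have "b \<in> nonzero_eigs_B \<alpha> R"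
    unfolding b_min_def by (rule Min_in[OF finite_nonzero_eigs nonzero_eigs_nonempty])
  then show ?thesis using eig_B_nonneg[of b] by (simp add: nonzero_eigs_B_def)
qed

lemma gap: "2 * (w / b) < \<beta> \<Longrightarrow> w < \<beta> * b - w"
  using b_min_pos by (simp add: field_simps)

lemma spectrum_dichotomy:
  assumes "z \<in> spectrum (A \<beta>)"
  shows "z \<in> disc \<alpha> \<eta> \<theta> \<beta> 0 \<or> (\<exists>l\<in>nonzero_eigs_B \<alpha> R. z \<in> disc \<alpha> \<eta> \<theta> \<beta> l)"
proof -
  obtain v where "v \<noteq> 0" "\<Omega> *v v - (\<i> * complex_of_real \<beta>) *s (B *v v) = z *s v"
    using assms by (rule spectrum_A_eigenvector)
  from damped_eigenvalue_near[OF norm_Omega hermitian_B this] obtain l where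
    "complex_of_real l \<in> spectrum B" "cmod (z + \<i> * complex_of_real \<beta> * complex_of_real l) \<le> w"
    by blast
  then show ?thesis by (cases "l = 0") (auto simp: disc_def nonzero_eigs_B_def)
qed

lemma disc_0_bound: "z \<in> disc \<alpha> \<eta> \<theta> \<beta> 0 \<Longrightarrow> cmod z \<le> w \<and> - Im z \<le> w"
  using abs_Im_le_cmod[of z] by (auto simp: disc_def)

lemma disc_pos_bound:
  assumes "\<beta> \<ge> 0" "l \<in> nonzero_eigs_B \<alpha> R" "z \<in> disc \<alpha> \<eta> \<theta> \<beta> l"
  shows "\<bar>Re z\<bar> \<le> w \<and> \<beta> * b - w \<le> - Im z"
proof -
  let ?u = "z + \<i> * complex_of_real \<beta> * complex_of_real l"
  have "\<bar>Re ?u\<bar> \<le> w" "\<bar>Im ?u\<bar> \<le> w"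
    using assms(3) abs_Re_le_cmod[of ?u] abs_Im_le_cmod[of ?u] by (auto simp: disc_def)
  then have "\<bar>Re z\<bar> \<le> w" "\<bar>Im z + \<beta> * l\<bar> \<le> w" by simp_all
  moreover have "\<beta> * b \<le> \<beta> * l" using assms b_min_le by (intro mult_left_mono) auto
  ultimately show ?thesis by linarith
qed

section \<open>The spectrum above the damping threshold\<close>

context
  fixes \<beta> :: real
  assumes \<beta>: "0 \<le> \<beta>" "2 * (w / b) < \<beta>"
begin

lemma sigma_0_eq: "sigma_0 \<alpha> \<eta> \<theta> R \<beta> = {z \<in> spectrum (A \<beta>). 0 \<le> - Im z \<and> - Im z \<le> w}"
proof -
  have "0 \<le> - Im z" if "z \<in> spectrum (A \<beta>)" for z
    using Im_spectrum[OF that] \<beta>(1) by (metis mult_nonneg_nonneg)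
  moreover have "z \<in> disc \<alpha> \<eta> \<theta> \<beta> 0" if "z \<in> spectrum (A \<beta>)" "- Im z \<le> w" for z
    using spectrum_dichotomy[OF that(1)] disc_pos_bound[OF \<beta>(1)] gap[OF \<beta>(2)] that(2) by fastforce
  ultimately show ?thesis using disc_0_bound by (auto simp: sigma_0_def)
qed

text \<open>The gap separates near from far eigenvalues by imaginary part and equally by modulus.
  The modulus criterion is the one that duality turns into
  \<open>cmod z < omega_min\<close>.\<close>

lemma far_eigenvalue_iff:
  assumes "z \<in> spectrum (A \<beta>)"
  shows "(\<exists>l\<in>nonzero_eigs_B \<alpha> R. z \<in> disc \<alpha> \<eta> \<theta> \<beta> l) \<longleftrightarrow> \<beta> * b - w \<le> - Im z"
    "\<beta> * b - w \<le> - Im z \<longleftrightarrow> w < cmod z"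
proof -
  have 1: "\<exists>l\<in>nonzero_eigs_B \<alpha> R. z \<in> disc \<alpha> \<eta> \<theta> \<beta> l" if "w < cmod z"
    using spectrum_dichotomy[OF assms] disc_0_bound[of z] that by force
  have 2: "\<beta> * b - w \<le> - Im z" if "\<exists>l\<in>nonzero_eigs_B \<alpha> R. z \<in> disc \<alpha> \<eta> \<theta> \<beta> l"
    using that disc_pos_bound[OF \<beta>(1)] by blast
  have 3: "w < cmod z" if "\<beta> * b - w \<le> - Im z"
    using that gap[OF \<beta>(2)] abs_Im_le_cmod[of z] by linarith
  show "(\<exists>l\<in>nonzero_eigs_B \<alpha> R. z \<in> disc \<alpha> \<eta> \<theta> \<beta> l) \<longleftrightarrow> \<beta> * b - w \<le> - Im z"
    "\<beta> * b - w \<le> - Im z \<longleftrightarrow> w < cmod z" using 1 2 3 by blast+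
qed

lemma sigma_1_eq: "sigma_1 \<alpha> \<eta> \<theta> R \<beta> = {z \<in> spectrum (A \<beta>). \<beta> * b - w \<le> - Im z}"
  using far_eigenvalue_iff(1) by (auto simp: sigma_1_def)

lemma Qfactor_far:
  assumes "z \<in> spectrum (A \<beta>)" "\<beta> * b - w \<le> - Im z"
  shows "Qfactor z \<le> ereal (1/2 * (w / (\<beta> * b - w)))"
  using far_eigenvalue_iff(1)[OF assms(1)] assms(2) disc_pos_bound[OF \<beta>(1)] gap[OF \<beta>(2)] omega_max_pos
  by (intro Qfactor_le) auto

text \<open>The inertia argument gives only \<open>- Im z \<ge> \<beta> * b / 2\<close>. This
  already exceeds \<open>w\<close>, so the eigenvalue is outside the near disc, and the dichotomy
  improves the bound.\<close>

lemma far_eigenvalue_exists: "\<exists>z\<in>spectrum (A \<beta>). \<beta> * b - w \<le> - Im z"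
proof -
  obtain x0 where x0: "B *v x0 \<noteq> 0" using B_nonzero by blast
  have "\<beta> * b > 2 * w" using gap[OF \<beta>(2)] by linarith
  moreover have "l = 0 \<or> b \<le> l" if "complex_of_real l \<in> spectrum B" for l
    using b_min_le[of l] that by (auto simp: nonzero_eigs_B_def)
  ultimately obtain z v where z: "v \<noteq> 0" "\<Omega> *v v - (\<i> * complex_of_real \<beta>) *s (B *v v) = z *s v"
      "- Im z \<ge> \<beta> * b / 2"
    using damped_eigenvalue_exists[OF norm_Omega hermitian_B _ b_min_pos \<beta>(1) _ x0] by blast
  have "z \<in> spectrum (A \<beta>)" using z(1,2) by (rule spectrum_A_I)
  moreover have "w < cmod z" using z(3) gap[OF \<beta>(2)] abs_Im_le_cmod[of z] by linarith
  ultimately show ?thesis using far_eigenvalue_iff(2) by blast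
qed

lemma gap_ratio: "1/2 * (w / (\<beta> * b - w)) < 1/2"
  using gap[OF \<beta>(2)] omega_max_pos by simp

end

end

text \<open>At \<beta> = 0 duality pairs the eigenvalues of \<open>\<Omega>\<close> with those of
  the dual operator by \<open>z\<close> and \<open>- 1 / z\<close>, so the least modulus is attained
  at the partner of the largest dual eigenvalue.\<close>

lemma omega_min_eq:
  assumes "damped_system \<alpha> \<eta> \<theta> R"
  shows "omega_min \<alpha> \<eta> \<theta> = 1 / omega_max \<eta> \<alpha> \<theta>"
proof -
  interpret damped_system \<alpha> \<eta> \<theta> R by fact
  interpret dual: damped_system \<eta> \<alpha> \<theta> R using assms by (rule damped_system_dual)
  show ?thesis unfolding omega_min_def
  proof (rule Min_eqI)
    show "finite (cmod ` spectrum \<Omega>)" by (simp add: finite_spectrum)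
    have "- 1 / complex_of_real dual.w \<in> spectrum \<Omega>"
      using spectrum_dual[OF dual.damped_system_axioms, of _ 0] dual.omega_max_in
      by (simp add: Amat_0)
    moreover have "cmod (- 1 / complex_of_real dual.w) = 1 / dual.w"
      using dual.omega_max_pos by (simp add: norm_divide)
    ultimately show "1 / dual.w \<in> cmod ` spectrum \<Omega>" by (metis imageI)
  next
    fix y assume "y \<in> cmod ` spectrum \<Omega>"
    then obtain z where z: "z \<in> spectrum \<Omega>" "y = cmod z" by blast
    have "z \<noteq> 0" using z(1) spectrum_nonzero[of 0] by (auto simp: Amat_0)
    have s: "- 1 / z \<in> spectrum dual.\<Omega>"
      using spectrum_dual[OF damped_system_axioms, of z 0] z(1) by (simp add: Amat_0)
    then have r: "complex_of_real (Re (- 1 / z)) = - 1 / z" by (rule dual.spectrum_Omega_real)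
    then have "\<bar>Re (- 1 / z)\<bar> \<le> dual.w" using s by (intro dual.spectrum_Omega_le) simp
    moreover have "\<bar>Re (- 1 / z)\<bar> = 1 / y"
      using arg_cong[OF r, of cmod] by (simp only: norm_of_real) (simp add: norm_divide z(2))
    ultimately have "1 / y \<le> dual.w" by simp
    then show "1 / dual.w \<le> y"
      using dual.omega_max_pos \<open>z \<noteq> 0\<close> by (simp add: z(2) field_simps)
  qed
qed

theorem corollary29:
  fixes \<alpha> \<eta> \<theta> R :: "real^'n^'n" and \<beta> :: real
  assumes "pos_def \<alpha>" and "psd \<eta>" and "transpose \<theta> = - \<theta>" and "psd R" and "rank R > 0"
    and "\<beta> \<ge> 0"
    and "pos_def \<eta>"
    and "\<beta> > max (2 * (omega_max \<alpha> \<eta> \<theta> / b_min \<alpha> R))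
                 (2 * (omega_max_flat \<alpha> \<eta> \<theta> / b_min_flat \<eta> R))"
  shows "spectrum_on (Amat \<alpha> \<eta> \<theta> R \<beta>) (H_ll \<alpha> \<eta> \<theta> R \<beta>)
           = {\<zeta> \<in> spectrum (Amat \<alpha> \<eta> \<theta> R \<beta>). 0 \<le> - Im \<zeta> \<and> - Im \<zeta> \<le> omega_max \<alpha> \<eta> \<theta>}
    \<and> spectrum_on (Amat \<alpha> \<eta> \<theta> R \<beta>) (H_hl \<alpha> \<eta> \<theta> R \<beta>)
           = {\<zeta> \<in> spectrum (Amat \<alpha> \<eta> \<theta> R \<beta>). - Im \<zeta> \<ge> \<beta> * b_min \<alpha> R - omega_max \<alpha> \<eta> \<theta>}
    \<and> \<beta> * b_min \<alpha> R - omega_max \<alpha> \<eta> \<theta> > omega_max \<alpha> \<eta> \<theta>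
    \<and> Max (Qfactor ` spectrum_on (Amat \<alpha> \<eta> \<theta> R \<beta>) (H_hl \<alpha> \<eta> \<theta> R \<beta>))
           \<le> ereal (1/2 * (omega_max \<alpha> \<eta> \<theta> / (\<beta> * b_min \<alpha> R - omega_max \<alpha> \<eta> \<theta>)))
    \<and> 1/2 * (omega_max \<alpha> \<eta> \<theta> / (\<beta> * b_min \<alpha> R - omega_max \<alpha> \<eta> \<theta>)) < 1/2
    \<and> spectrum_on (Amat \<alpha> \<eta> \<theta> R \<beta>) (H_ll0 \<alpha> \<eta> \<theta> R \<beta>)
           = {\<zeta> \<in> spectrum (Amat \<alpha> \<eta> \<theta> R \<beta>).
                - Im \<zeta> / (cmod \<zeta>)\<^sup>2 \<ge> \<beta> * b_min_flat \<eta> R - omega_max_flat \<alpha> \<eta> \<theta>}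
    \<and> \<beta> * b_min_flat \<eta> R - omega_max_flat \<alpha> \<eta> \<theta> > omega_max_flat \<alpha> \<eta> \<theta>
    \<and> Max (Qfactor ` spectrum_on (Amat \<alpha> \<eta> \<theta> R \<beta>) (H_ll0 \<alpha> \<eta> \<theta> R \<beta>))
           \<le> ereal (1/2 * (omega_max_flat \<alpha> \<eta> \<theta> / (\<beta> * b_min_flat \<eta> R - omega_max_flat \<alpha> \<eta> \<theta>)))
    \<and> 1/2 * (omega_max_flat \<alpha> \<eta> \<theta> / (\<beta> * b_min_flat \<eta> R - omega_max_flat \<alpha> \<eta> \<theta>)) < 1/2
    \<and> Max (cmod ` spectrum_on (Amat \<alpha> \<eta> \<theta> R \<beta>) (H_ll0 \<alpha> \<eta> \<theta> R \<beta>))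
           \<le> 1 / (\<beta> * b_min_flat \<eta> R - omega_max_flat \<alpha> \<eta> \<theta>)
    \<and> 1 / (\<beta> * b_min_flat \<eta> R - omega_max_flat \<alpha> \<eta> \<theta>) < omega_min \<alpha> \<eta> \<theta>"
proof -
  interpret damped_system \<alpha> \<eta> \<theta> R by unfold_locales (use assms in auto)
  note sys = damped_system_axioms
  interpret dual: damped_system \<eta> \<alpha> \<theta> R using sys by (rule damped_system_dual)
  have \<beta>: "0 \<le> \<beta>" "2 * (w / b) < \<beta>" and \<beta>': "2 * (dual.w / dual.b) < \<beta>"
    using assms(6,8) by (auto simp: omega_max_flat_def b_min_flat_def)
  let ?d = "\<beta> * dual.b - dual.w"
  note gap = gap[OF \<beta>(2)] and gap' = dual.gap[OF \<beta>']
  have d: "0 < ?d" using gap' dual.omega_max_pos by linarith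
  have ll: "spectrum_on (A \<beta>) (H_ll \<alpha> \<eta> \<theta> R \<beta>) = sigma_0 \<alpha> \<eta> \<theta> R \<beta>"
    unfolding H_ll_def by (rule spectrum_on_gen_eigenspace_sum) (auto simp: sigma_0_def)
  have hl: "spectrum_on (A \<beta>) (H_hl \<alpha> \<eta> \<theta> R \<beta>) = {z \<in> spectrum (A \<beta>). \<beta> * b - w \<le> - Im z}"
    unfolding H_hl_def sigma_1_eq[OF \<beta>, symmetric]
    by (rule spectrum_on_gen_eigenspace_sum) (auto simp: sigma_1_def)
  \<comment> \<open>The modulus criterion for far eigenvalues of the dual, applied to
    \<open>- 1 / z\<close>, is exactly the inequality that defines \<open>H_ll0\<close>.\<close>
  have far: "?d \<le> - Im (- 1 / z) \<longleftrightarrow> cmod z < omega_min \<alpha> \<eta> \<theta>"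
    and dual_mem: "- 1 / z \<in> spectrum (dual.A \<beta>)" and nz: "z \<noteq> 0"
    if "z \<in> spectrum (A \<beta>)" for z
  proof -
    show "z \<noteq> 0" using that spectrum_nonzero by auto
    then have "dual.w < cmod (- 1 / z) \<longleftrightarrow> cmod z < 1 / dual.w"
      using dual.omega_max_pos by (simp add: norm_divide field_simps)
    moreover show mem: "- 1 / z \<in> spectrum (dual.A \<beta>)" using spectrum_dual[OF sys that] .
    ultimately show "?d \<le> - Im (- 1 / z) \<longleftrightarrow> cmod z < omega_min \<alpha> \<eta> \<theta>"
      using dual.far_eigenvalue_iff(2)[OF \<beta>(1) \<beta>' mem] omega_min_eq[OF sys] by simp
  qed
  have ll0: "spectrum_on (A \<beta>) (H_ll0 \<alpha> \<eta> \<theta> R \<beta>) = {z \<in> spectrum (A \<beta>). ?d \<le> - Im (- 1 / z)}"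
    (is "_ = ?S")
  proof -
    have "spectrum_on (A \<beta>) (H_ll0 \<alpha> \<eta> \<theta> R \<beta>) = {z \<in> spectrum (A \<beta>). cmod z < omega_min \<alpha> \<eta> \<theta>}"
      unfolding H_ll0_def by (rule spectrum_on_gen_eigenspace_sum) auto
    then show ?thesis using far by auto
  qed
  have finS: "finite ?S" using finite_spectrum[of "A \<beta>"] by simp
  \<comment> \<open>The map from \<open>z\<close> to \<open>- 1 / z\<close> is an involution, so a
    far eigenvalue of the dual comes back as an element of \<open>?S\<close>.\<close>
  have "?S \<noteq> {}"
  proof -
    obtain z where z: "z \<in> spectrum (dual.A \<beta>)" "?d \<le> - Im z"
      using dual.far_eigenvalue_exists[OF \<beta>(1) \<beta>'] by blast
    have "- 1 / z \<in> ?S" using spectrum_dual[OF dual.damped_system_axioms z(1)] z(2) by simp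
    then show ?thesis by blast
  qed
  note S = finS this
  have "Max (Qfactor ` {z \<in> spectrum (A \<beta>). \<beta> * b - w \<le> - Im z}) \<le> ereal (1/2 * (w / (\<beta> * b - w)))"
    using finite_spectrum[of "A \<beta>"] far_eigenvalue_exists[OF \<beta>] Qfactor_far[OF \<beta>]
    by (intro Max.boundedI) auto
  moreover have "Max (Qfactor ` ?S) \<le> ereal (1/2 * (dual.w / ?d))"
  proof (intro Max.boundedI)
    fix y assume "y \<in> Qfactor ` ?S"
    then obtain z where z: "z \<in> ?S" "y = Qfactor z" by blast
    then show "y \<le> ereal (1/2 * (dual.w / ?d))"
      using dual.Qfactor_far[OF \<beta>(1) \<beta>' dual_mem[of z]] unfolding Qfactor_minus_inverse by auto
  qed (use S in auto)
  moreover have "Max (cmod ` ?S) \<le> 1 / ?d"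
  proof (intro Max.boundedI)
    fix y assume "y \<in> cmod ` ?S"
    then obtain z where z: "z \<in> spectrum (A \<beta>)" "?d \<le> - Im (- 1 / z)" "y = cmod z" by blast
    \<comment> \<open>The modulus of \<open>- 1 / z\<close> dominates its damping rate, and taking
      reciprocals bounds \<open>cmod z\<close> from above.\<close>
    have "?d \<le> cmod (- 1 / z)" using z(2) abs_Im_le_cmod[of "- 1 / z"] by linarith
    then show "y \<le> 1 / ?d" using nz[OF z(1)] d by (simp add: z(3) norm_divide field_simps)
  qed (use S in auto)
  \<comment> \<open>The reciprocal form of the dual gap \<open>dual.w < ?d\<close>.\<close>
  moreover have "1 / ?d < omega_min \<alpha> \<eta> \<theta>"
    unfolding omega_min_eq[OF sys] using gap' dual.omega_max_pos by (intro divide_strict_left_mono) auto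
  ultimately show ?thesis
    unfolding ll hl ll0 sigma_0_eq[OF \<beta>] omega_max_flat_def b_min_flat_def
    using gap gap' gap_ratio[OF \<beta>] dual.gap_ratio[OF \<beta>(1) \<beta>']
    \<comment> \<open>Brings the dual damping rate \<open>- Im (- 1 / z)\<close> into the form
      \<open>- Im z / (cmod z)\<^sup>2\<close> of the statement.\<close>
    unfolding Im_minus_inverse minus_divide_left by simp
qed

end
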